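(* Let $h_\omega$ be the discrete random Schrödinger operator on $\ell^2(\mathbb{Z}^\nu)$, $\mathbb{Z}^\nu=\mathbb{Z}^{\nu_1}\oplus\mathbb{Z}^{\nu_2}$, given by $$(h_\omega u)(\mathbf{n})=(h_0u)(\mathbf{n})+\widetilde V_\omega(\mathbf{n}_1)\,\delta(\mathbf{n}_2)\,u(\mathbf{n}),\qquad (h_0u)(\mathbf{n})=\sum_{|\mathbf{j}|=1}u(\mathbf{n}-\mathbf{j}),\qquad \mathbf{n}=(\mathbf{n}_1,\mathbf{n}_2)\in\mathbb{Z}^{\nu_1}\oplus\mathbb{Z}^{\nu_2},$$ where $\delta(\mathbf{n}_2)$ is the Kronecker symbol ($1$ if $\mathbf{n}_2=0$ and $0$ otherwise) and $\widetilde V_\omega$ is a real-valued metrically transitive random field on $\mathbb{Z}^{\nu_1}$. Let $\Xi$ be the associated (signed) density of surface states measure, i.e. the signed Borel measure on $\mathbb{R}$ such that almost surely, for every $g\in C_0^1(\mathbb{R})$, $$\int_{\mathbb{R}}g(\lambda)\,d\Xi(\lambda)=\lim_{\Lambda\to\infty}\frac{1}{\mathrm{meas}_{\nu_1}(\Lambda)}\int_{\mathbb{R}}g(\lambda)\,\xi(\lambda;h_0+V_{\omega,\Lambda},h_0)\,d\lambda .$$ Then $\Xi$ is absolutely continuous with respect to Lebesgue measure on $\mathbb{R}$.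
   Context: Here $\nu\ge 2$, $\nu_1+\nu_2=\nu$, $\nu_1\ge 1$, $\nu_2\ge 1$. The sum over $|\mathbf{j}|=1$ runs over the $2\nu$ nearest neighbours of the origin in $\mathbb{Z}^\nu$. Metrically transitive random field: $\widetilde V_\omega(\mathbf{n}_1)$, $\mathbf{n}_1\in\mathbb{Z}^{\nu_1}$, are random variables on a probability space $(\Omega,\mathfrak{F},\mathbb{P})$ and there are measure preserving ergodic transformations $\{T_{\mathbf{k}}\}_{\mathbf{k}\in\mathbb{Z}^{\nu_1}}$ of $\Omega$ with $\widetilde V_{T_{\mathbf{k}}\omega}(\mathbf{j})=\widetilde V_\omega(\mathbf{j}-\mathbf{k})$ for all $\omega\in\Omega$. Boxes: $\Lambda=[a_1,b_1]\times\dots\times[a_{\nu_1},b_{\nu_1}]\subset\mathbb{R}^{\nu_1}$ is a rectangular box with integer-valued vertices; $\mathrm{meas}_{\nu_1}$ is Lebesgue measure on $\mathbb{R}^{\nu_1}$; $\Lambda\to\infty$ means $a_i\to-\infty$ and $b_i\to\infty$ for all $i$. For such a box, $V_{\omega,\Lambda}$ is the multiplication operator with $V_{\omega,\Lambda}(\mathbf{n})=\widetilde V_\omega(\mathbf{n}_1)\delta(\mathbf{n}_2)$ if $\mathbf{n}_1\in\Lambda$ and $V_{\omega,\Lambda}(\mathbf{n})=0$ otherwise; it has finite rank. Spectral shift function: for bounded self-adjoint $A$ and trace class self-adjoint $C$, $\xi(\cdot;A+C,A)\in L^1(\mathbb{R})$ is defined by the trace formula $\mathrm{tr}(\phi(A+C)-\phi(A))=\int_{\mathbb{R}}\phi'(\lambda)\,\xi(\lambda;A+C,A)\,d\lambda$,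 valid for a sufficiently wide class of functions $\phi$ (for example $\phi\in C_0^\infty(\mathbb{R})$). Known fact used to define $\Xi$: for every $g\in C_0^1(\mathbb{R})$ (compactly supported $C^1$ functions) the limit in the claim exists almost surely and is non-random; the resulting linear functional extends to all $g\in C_0(\mathbb{R})$ (compactly supported continuous functions) and is represented as $g\mapsto\int g\,d\Xi$ by a signed Borel measure $\Xi$ on $\mathbb{R}$ (finite on bounded Borel sets). *)

theory Defs
  imports "HOL-Probability.Probability" "HOL-Computational_Algebra.Polynomial"
begin

section \<open>The Hilbert space of square summable complex functions\<close>

typedef 'a ell2 = "{f :: 'a \<Rightarrow> complex. (\<lambda>a. (cmod (f a))\<^sup>2) summable_on UNIV}"
  morphisms coord Abs_ell2
  by (rule exI[of _ "\<lambda>_. 0"]) simp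

lemma coord_summable: "(\<lambda>a. (cmod (coord x a))\<^sup>2) summable_on UNIV"
  using coord[of x] by simp

lemma coord_Abs_ell2:
  "(\<lambda>a. (cmod (f a))\<^sup>2) summable_on UNIV \<Longrightarrow> coord (Abs_ell2 f) = f"
  by (rule Abs_ell2_inverse) simp

lemma ell2_eqI: "(\<And>a. coord x a = coord y a) \<Longrightarrow> x = y"
  using coord_inject by blast

lemma square_summable_add:
  fixes f g :: "'a \<Rightarrow> complex"
  assumes "(\<lambda>a. (cmod (f a))\<^sup>2) summable_on UNIV" "(\<lambda>a. (cmod (g a))\<^sup>2) summable_on UNIV"
  shows "(\<lambda>a. (cmod (f a + g a))\<^sup>2) summable_on UNIV"
proof (rule summable_on_comparison_test)
  show "(\<lambda>a. 2 * (cmod (f a))\<^sup>2 + 2 * (cmod (g a))\<^sup>2) summable_on UNIV"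
    using assms by (intro summable_on_add summable_on_cmult_right)
  fix a
  have "(cmod (f a + g a))\<^sup>2 \<le> (cmod (f a) + cmod (g a))\<^sup>2"
    by (intro power_mono norm_triangle_ineq) simp
  also have "\<dots> \<le> 2 * (cmod (f a))\<^sup>2 + 2 * (cmod (g a))\<^sup>2"
    using zero_le_power2[of "cmod (f a) - cmod (g a)"]
    by (simp add: power2_sum power2_diff)
  finally show "(cmod (f a + g a))\<^sup>2 \<le> 2 * (cmod (f a))\<^sup>2 + 2 * (cmod (g a))\<^sup>2" .
qed simp

lemma square_summable_bounded_mult:
  fixes f v :: "'a \<Rightarrow> complex"
  assumes "(\<lambda>a. (cmod (f a))\<^sup>2) summable_on UNIV" "\<And>a. cmod (v a) \<le> K"
  shows "(\<lambda>a. (cmod (v a * f a))\<^sup>2) summable_on UNIV"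
proof (rule summable_on_comparison_test)
  show "(\<lambda>a. K\<^sup>2 * (cmod (f a))\<^sup>2) summable_on UNIV"
    using assms(1) by (rule summable_on_cmult_right)
  show "(cmod (v a * f a))\<^sup>2 \<le> K\<^sup>2 * (cmod (f a))\<^sup>2" for a
    using assms(2)[of a] by (simp add: norm_mult power_mult_distrib mult_right_mono power_mono)
qed simp

instantiation ell2 :: (type) real_vector
begin

definition zero_ell2 :: "'a ell2" where "0 = Abs_ell2 (\<lambda>_. 0)"
definition plus_ell2 :: "'a ell2 \<Rightarrow> 'a ell2 \<Rightarrow> 'a ell2"
  where "x + y = Abs_ell2 (\<lambda>a. coord x a + coord y a)"
definition uminus_ell2 :: "'a ell2 \<Rightarrow> 'a ell2"
  where "- x = Abs_ell2 (\<lambda>a. - coord x a)"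
definition minus_ell2 :: "'a ell2 \<Rightarrow> 'a ell2 \<Rightarrow> 'a ell2"
  where "x - y = Abs_ell2 (\<lambda>a. coord x a - coord y a)"
definition scaleR_ell2 :: "real \<Rightarrow> 'a ell2 \<Rightarrow> 'a ell2"
  where "c *\<^sub>R x = Abs_ell2 (\<lambda>a. c *\<^sub>R coord x a)"

lemma coord_zero [simp]: "coord 0 a = 0"
  by (simp add: zero_ell2_def coord_Abs_ell2)

lemma coord_add [simp]: "coord (x + y) a = coord x a + coord y a"
  by (simp add: plus_ell2_def coord_Abs_ell2 square_summable_add coord_summable)

lemma coord_uminus [simp]: "coord (- x) a = - coord x a"
  by (simp add: uminus_ell2_def coord_Abs_ell2 coord_summable)

lemma coord_diff [simp]: "coord (x - y) a = coord x a - coord y a"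
  using square_summable_add[OF coord_summable[of x], of "\<lambda>a. - coord y a"]
  by (simp add: minus_ell2_def coord_Abs_ell2 coord_summable)

lemma coord_scaleR [simp]: "coord (c *\<^sub>R x) a = c *\<^sub>R coord x a"
  using square_summable_bounded_mult[OF coord_summable[of x], of "\<lambda>_. of_real c" "\<bar>c\<bar>"]
  by (simp add: scaleR_ell2_def coord_Abs_ell2 scaleR_conv_of_real)

instance
  by standard (auto intro!: ell2_eqI simp: algebra_simps)

end

definition cinner :: "'a ell2 \<Rightarrow> 'a ell2 \<Rightarrow> complex"
  where "cinner x y = (\<Sum>\<^sub>\<infinity>a. cnj (coord x a) * coord y a)"

lemma cinner_summable: "(\<lambda>a. cnj (coord x a) * coord y a) summable_on UNIV"
proof (rule abs_summable_summable, rule summable_on_comparison_test)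
  show "(\<lambda>a. (cmod (coord x a))\<^sup>2 + (cmod (coord y a))\<^sup>2) summable_on UNIV"
    by (intro summable_on_add coord_summable)
  fix a
  have "cmod (coord x a) * cmod (coord y a) * 2 \<le> (cmod (coord x a))\<^sup>2 + (cmod (coord y a))\<^sup>2"
    using zero_le_power2[of "cmod (coord x a) - cmod (coord y a)"]
    by (simp add: power2_diff)
  moreover have "0 \<le> cmod (coord x a) * cmod (coord y a)" by simp
  ultimately show "cmod (cnj (coord x a) * coord y a) \<le> (cmod (coord x a))\<^sup>2 + (cmod (coord y a))\<^sup>2"
    unfolding norm_mult complex_mod_cnj by linarith
qed simp

lemma cinner_commute: "cinner y x = cnj (cinner x y)"
  unfolding cinner_def infsum_cnj[symmetric] by (simp add: mult.commute)

lemma cinner_add_left: "cinner (x + y) z = cinner x z + cinner y z"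
  unfolding cinner_def
  by (simp add: distrib_right infsum_add[OF cinner_summable cinner_summable])

lemma cinner_scaleR_left: "cinner (c *\<^sub>R x) y = c *\<^sub>R cinner x y"
  unfolding cinner_def scaleR_conv_of_real
  by (simp add: scaleR_conv_of_real mult.assoc infsum_cmult_right')

lemma cinner_self: "cinner x x = of_real (\<Sum>\<^sub>\<infinity>a. (cmod (coord x a))\<^sup>2)"
proof -
  have "((\<lambda>a. complex_of_real ((cmod (coord x a))\<^sup>2)) has_sum
      of_real (\<Sum>\<^sub>\<infinity>a. (cmod (coord x a))\<^sup>2)) UNIV"
    by (intro has_sum_of_real has_sum_infsum coord_summable)
  moreover have "complex_of_real ((cmod (coord x a))\<^sup>2) = cnj (coord x a) * coord x a" for a
    by (metis complex_norm_square mult.commute)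
  ultimately show ?thesis
    unfolding cinner_def by (simp add: infsumI)
qed

instantiation ell2 :: (type) real_inner
begin

definition inner_ell2 :: "'a ell2 \<Rightarrow> 'a ell2 \<Rightarrow> real"
  where "inner_ell2 x y = Re (cinner x y)"
definition norm_ell2 :: "'a ell2 \<Rightarrow> real"
  where "norm_ell2 x = sqrt (\<Sum>\<^sub>\<infinity>a. (cmod (coord x a))\<^sup>2)"
definition sgn_ell2 :: "'a ell2 \<Rightarrow> 'a ell2"
  where "sgn_ell2 x = x /\<^sub>R norm x"
definition dist_ell2 :: "'a ell2 \<Rightarrow> 'a ell2 \<Rightarrow> real"
  where "dist_ell2 x y = norm (x - y)"
definition uniformity_ell2 :: "('a ell2 \<times> 'a ell2) filter"
  where "uniformity_ell2 = (INF e\<in>{0<..}. principal {(x, y). dist x y < e})"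
definition open_ell2 :: "'a ell2 set \<Rightarrow> bool"
  where "open_ell2 U \<longleftrightarrow> (\<forall>x\<in>U. eventually (\<lambda>(x', y). x' = x \<longrightarrow> y \<in> U) uniformity)"

instance
proof
  fix x y z :: "'a ell2" and r :: real
  show "inner x y = inner y x"
    using cinner_commute[of y x] by (simp add: inner_ell2_def)
  show "inner x x = 0 \<longleftrightarrow> x = 0"
  proof
    assume "inner x x = 0"
    then have *: "(\<Sum>\<^sub>\<infinity>a. (cmod (coord x a))\<^sup>2) = 0"
      by (simp add: inner_ell2_def cinner_self)
    have "(cmod (coord x a))\<^sup>2 = 0" for a
      by (rule nonneg_infsum_le_0D[OF _ coord_summable]) (use * in auto)
    then show "x = 0"
      by (intro ell2_eqI) simp
  qed (simp add: inner_ell2_def cinner_self)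
qed (auto simp: inner_ell2_def cinner_add_left cinner_scaleR_left cinner_self norm_ell2_def
        sgn_ell2_def dist_ell2_def uniformity_ell2_def open_ell2_def intro!: infsum_nonneg)

end

definition ket :: "'a \<Rightarrow> 'a ell2"
  where "ket a = Abs_ell2 (\<lambda>b. if b = a then 1 else 0)"

lemma coord_ket: "coord (ket a) b = (if b = a then 1 else 0)"
proof -
  have "(\<lambda>b. (cmod (if b = a then 1 else 0))\<^sup>2) summable_on UNIV"
    by (rule summable_on_cong_neutral[THEN iffD1, OF _ _ _ summable_on_finite[of "{a}"]])
       auto
  then show ?thesis
    by (simp add: ket_def coord_Abs_ell2)
qed


section \<open>Bounded self-adjoint operators\<close>

text \<open>
  The operators in the type \<^typ>\<open>'a ell2 \<Rightarrow>\<^sub>L 'a ell2\<close> are only real-linear. Symmetry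
  with respect to the complex inner product forces complex linearity.
\<close>

definition selfadjoint :: "('a ell2 \<Rightarrow>\<^sub>L 'a ell2) \<Rightarrow> bool"
  where "selfadjoint A \<longleftrightarrow> (\<forall>x y. cinner x (blinfun_apply A y) = cinner (blinfun_apply A x) y)"

definition poly_op :: "real poly \<Rightarrow> ('a ell2 \<Rightarrow>\<^sub>L 'a ell2) \<Rightarrow> ('a ell2 \<Rightarrow>\<^sub>L 'a ell2)"
  where "poly_op p A = (\<Sum>k\<le>degree p. coeff p k *\<^sub>R ((\<lambda>B. A o\<^sub>L B) ^^ k) id_blinfun)"

text \<open>
  Continuous functional calculus of a bounded self-adjoint operator: the norm limit of
  \<open>p\<^sub>n(A)\<close> for polynomials \<open>p\<^sub>n\<close> converging to \<open>\<phi>\<close> uniformly on \<open>[-\<parallel>A\<parallel>, \<parallel>A\<parallel>]\<close>, an interval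
  that contains the spectrum of \<open>A\<close>.
\<close>

definition fun_calc :: "(real \<Rightarrow> real) \<Rightarrow> ('a ell2 \<Rightarrow>\<^sub>L 'a ell2) \<Rightarrow> ('a ell2 \<Rightarrow>\<^sub>L 'a ell2)"
  where "fun_calc \<phi> A = (THE B. \<forall>p :: nat \<Rightarrow> real poly.
    uniform_limit {- norm A..norm A} (\<lambda>n. poly (p n)) \<phi> sequentially
      \<longrightarrow> (\<lambda>n. poly_op (p n) A) \<longlonglongrightarrow> B)"

text \<open>For self-adjoint \<open>T\<close> the operator \<open>|T| = (T\<^sup>*T)\<^bsup>1/2\<^esup>\<close> is \<open>fun_calc abs T\<close>.\<close>

definition selfadjoint_trace_class :: "('a ell2 \<Rightarrow>\<^sub>L 'a ell2) \<Rightarrow> bool"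
  where "selfadjoint_trace_class T \<longleftrightarrow> selfadjoint T \<and>
    (\<lambda>a. cinner (ket a) (blinfun_apply (fun_calc abs T) (ket a))) summable_on UNIV"

definition op_trace :: "('a ell2 \<Rightarrow>\<^sub>L 'a ell2) \<Rightarrow> complex"
  where "op_trace T = (\<Sum>\<^sub>\<infinity>a. cinner (ket a) (blinfun_apply T (ket a)))"


section \<open>The spectral shift function\<close>

definition C0_infinity :: "(real \<Rightarrow> real) set"
  where "C0_infinity = {\<phi>. (\<forall>k x. (deriv ^^ k) \<phi> field_differentiable at x) \<and>
    bounded {x. \<phi> x \<noteq> 0}}"

definition C0_1 :: "(real \<Rightarrow> real) set"
  where "C0_1 = {g. g C1_differentiable_on UNIV \<and> bounded {x. g x \<noteq> 0}}"

text \<open>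
  The trace formula determines \<open>\<xi>\<close> only up to modification on Lebesgue null sets, so being
  a spectral shift function is a predicate on \<open>\<xi>\<close>.
\<close>

definition is_spectral_shift ::
    "('a ell2 \<Rightarrow>\<^sub>L 'a ell2) \<Rightarrow> ('a ell2 \<Rightarrow>\<^sub>L 'a ell2) \<Rightarrow> (real \<Rightarrow> real) \<Rightarrow> bool"
  where "is_spectral_shift A C \<xi> \<longleftrightarrow>
    selfadjoint A \<and> selfadjoint_trace_class C \<and> integrable lborel \<xi> \<and>
    (\<forall>\<phi>\<in>C0_infinity.
      selfadjoint_trace_class (fun_calc \<phi> (A + C) - fun_calc \<phi> A) \<and>
      op_trace (fun_calc \<phi> (A + C) - fun_calc \<phi> A)
        = of_real (\<integral>t. deriv \<phi> t * \<xi> t \<partial>lborel))"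


section \<open>The lattice operators\<close>

type_synonym ('n, 'm) lattice = "(int ^ 'n) \<times> (int ^ 'm)"

definition neighbours :: "('n::finite, 'm::finite) lattice set"
  where "neighbours = {j. (\<Sum>i\<in>UNIV. (fst j $ i)\<^sup>2) + (\<Sum>i\<in>UNIV. (snd j $ i)\<^sup>2) = 1}"

definition h0 :: "('n::finite, 'm::finite) lattice ell2 \<Rightarrow>\<^sub>L ('n, 'm) lattice ell2"
  where "h0 = Blinfun (\<lambda>u. Abs_ell2 (\<lambda>n. \<Sum>j\<in>neighbours. coord u (n - j)))"

definition mult_op :: "('a \<Rightarrow> real) \<Rightarrow> 'a ell2 \<Rightarrow>\<^sub>L 'a ell2"
  where "mult_op v = Blinfun (\<lambda>u. Abs_ell2 (\<lambda>n. of_real (v n) * coord u n))"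

definition real_vec :: "int ^ 'n \<Rightarrow> real ^ 'n"
  where "real_vec a = (\<chi> i. of_int (a $ i))"

definition surface_potential :: "(int ^ 'n \<Rightarrow> real) \<Rightarrow> ('n, 'm::finite) lattice \<Rightarrow> real"
  where "surface_potential v n = v (fst n) * (if snd n = 0 then 1 else 0)"

definition V_box :: "(int ^ 'n::finite \<Rightarrow> real) \<Rightarrow> (real ^ 'n) set \<Rightarrow>
    ('n, 'm::finite) lattice ell2 \<Rightarrow>\<^sub>L ('n, 'm) lattice ell2"
  where "V_box v \<Lambda> = mult_op (\<lambda>n. if real_vec (fst n) \<in> \<Lambda> then surface_potential v n else 0)"

text \<open>
  The operators above are given through \<^const>\<open>Abs_ell2\<close> and \<^const>\<open>Blinfun\<close>; the following
  facts show that they act as intended.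
\<close>

lemma finite_neighbours: "finite (neighbours :: ('n::finite, 'm::finite) lattice set)"
proof -
  have bnd: "finite {x :: int ^ 'k::finite. \<forall>i. x $ i \<in> {-1..1}}"
  proof (rule finite_imageD)
    show "finite (vec_nth ` {x :: int ^ 'k. \<forall>i. x $ i \<in> {-1..1}})"
      by (rule finite_subset[OF _ finite_PiE[of UNIV "\<lambda>_. {-1..1::int}"]]) auto
  qed (auto simp: inj_on_def vec_nth_inject)
  have sq: "y \<in> {-1..1}" if "y\<^sup>2 \<le> 1" for y :: int
    using that abs_le_square_iff[of y 1] by auto
  have "neighbours \<subseteq> {x :: int ^ 'n. \<forall>i. x $ i \<in> {-1..1}} \<times> {x :: int ^ 'm. \<forall>i. x $ i \<in> {-1..1}}"
  proof (clarsimp simp only: neighbours_def mem_Collect_eq mem_Times_iff fst_conv snd_conv, intro conjI allI)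
    fix x :: "int ^ 'n" and y :: "int ^ 'm"
    assume s: "(\<Sum>i\<in>UNIV. (x $ i)\<^sup>2) + (\<Sum>i\<in>UNIV. (y $ i)\<^sup>2) = 1"
    have "0 \<le> (\<Sum>i\<in>UNIV. (x $ i)\<^sup>2)" "0 \<le> (\<Sum>i\<in>UNIV. (y $ i)\<^sup>2)"
      by (simp_all add: sum_nonneg)
    moreover have "(x $ i)\<^sup>2 \<le> (\<Sum>i\<in>UNIV. (x $ i)\<^sup>2)" for i
      by (rule member_le_sum) auto
    moreover have "(y $ i)\<^sup>2 \<le> (\<Sum>i\<in>UNIV. (y $ i)\<^sup>2)" for i
      by (rule member_le_sum) auto
    ultimately have "(x $ i)\<^sup>2 \<le> 1" "(y $ j)\<^sup>2 \<le> 1" for i j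
      using s by (smt (verit))+
    then show "x $ i \<in> {-1..1}" "y $ j \<in> {-1..1}" for i j
      using sq by blast+
  qed
  then show ?thesis
    by (rule finite_subset) (intro finite_cartesian_product bnd)
qed

definition shift :: "'a::ab_group_add \<Rightarrow> 'a ell2 \<Rightarrow> 'a ell2"
  where "shift j u = Abs_ell2 (\<lambda>n. coord u (n - j))"

lemma bij_minus: "bij (\<lambda>n. n - j :: 'a::ab_group_add)"
  by (rule bij_betw_byWitness[where f' = "\<lambda>n. n + j"]) auto

lemma coord_shift: "coord (shift j u) n = coord u (n - j)"
proof -
  have "(\<lambda>n. (cmod (coord u (n - j)))\<^sup>2) summable_on UNIV"
    using coord_summable[of u]
      summable_on_reindex_bij_betw[OF bij_minus[of j], of "\<lambda>n. (cmod (coord u n))\<^sup>2"] by simp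
  then show ?thesis
    by (simp add: shift_def coord_Abs_ell2)
qed

lemma norm_shift: "norm (shift j u) = norm u"
  unfolding norm_ell2_def coord_shift
  by (simp add: infsum_reindex_bij_betw[OF bij_minus, of "\<lambda>n. (cmod (coord u n))\<^sup>2"])

lemma bounded_linear_shift: "bounded_linear (shift j)"
  by (rule bounded_linear_intro[of _ 1]) (auto intro!: ell2_eqI simp: coord_shift norm_shift)

lemma coord_sum: "finite S \<Longrightarrow> coord (\<Sum>j\<in>S. u j) n = (\<Sum>j\<in>S. coord (u j) n)"
  by (induction S rule: finite_induct) auto

lemma coord_h0: "coord (blinfun_apply h0 u) n = (\<Sum>j\<in>neighbours. coord u (n - j))"
proof -
  have eq: "Abs_ell2 (\<lambda>n. \<Sum>j\<in>neighbours. coord u (n - j)) = (\<Sum>j\<in>neighbours. shift j u)"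
    for u :: "('a, 'b) lattice ell2"
  proof -
    have "(\<lambda>n. \<Sum>j\<in>neighbours. coord u (n - j)) = coord (\<Sum>j\<in>neighbours. shift j u)"
      by (simp add: fun_eq_iff coord_sum finite_neighbours coord_shift)
    then show ?thesis
      by (simp add: coord_inverse)
  qed
  have "bounded_linear (\<lambda>u :: ('a, 'b) lattice ell2. \<Sum>j\<in>neighbours. shift j u)"
    by (intro bounded_linear_sum bounded_linear_shift)
  then show ?thesis
    by (simp add: h0_def eq bounded_linear_Blinfun_apply coord_sum finite_neighbours coord_shift)
qed

lemma coord_mult_op:
  assumes "\<And>n. \<bar>v n\<bar> \<le> K"
  shows "coord (blinfun_apply (mult_op v) u) n = of_real (v n) * coord u n"
proof -
  have sum: "(\<lambda>n. (cmod (of_real (v n) * coord u n))\<^sup>2) summable_on UNIV" for u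
    by (rule square_summable_bounded_mult[of _ _ K]) (use assms in \<open>auto intro: coord_summable\<close>)
  define f where "f u = Abs_ell2 (\<lambda>n. of_real (v n) * coord u n)" for u
  have coord_f: "coord (f u) n = of_real (v n) * coord u n" for u n
    unfolding f_def coord_Abs_ell2[OF sum] ..
  have "bounded_linear f"
  proof (rule bounded_linear_intro[of _ K])
    fix u :: "'a ell2"
    have "0 \<le> K" using assms[of undefined] by linarith
    have "(\<Sum>\<^sub>\<infinity>n. (cmod (of_real (v n) * coord u n))\<^sup>2) \<le> (\<Sum>\<^sub>\<infinity>n. K\<^sup>2 * (cmod (coord u n))\<^sup>2)"
    proof (rule infsum_mono)
      show "(cmod (of_real (v n) * coord u n))\<^sup>2 \<le> K\<^sup>2 * (cmod (coord u n))\<^sup>2" for n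
        using power_mono[OF assms[of n], of 2]
        by (simp add: norm_mult power_mult_distrib mult_right_mono)
    qed (intro sum summable_on_cmult_right coord_summable)+
    also have "\<dots> = (\<Sum>\<^sub>\<infinity>n. (cmod (coord u n))\<^sup>2) * K\<^sup>2"
      by (simp add: infsum_cmult_right' mult.commute)
    finally have "sqrt (\<Sum>\<^sub>\<infinity>n. (cmod (of_real (v n) * coord u n))\<^sup>2)
        \<le> sqrt ((\<Sum>\<^sub>\<infinity>n. (cmod (coord u n))\<^sup>2) * K\<^sup>2)"
      by (rule real_sqrt_le_mono)
    also have "\<dots> = norm u * K"
      using \<open>0 \<le> K\<close> by (simp add: norm_ell2_def real_sqrt_mult)
    finally show "norm (f u) \<le> norm u * K"
      by (simp add: norm_ell2_def[of "f u"] coord_f)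
  qed (auto intro!: ell2_eqI simp: coord_f algebra_simps)
  then show ?thesis
    by (simp add: mult_op_def f_def[symmetric] bounded_linear_Blinfun_apply coord_f)
qed


section \<open>Boxes\<close>

definition lattice_box :: "int ^ 'n::finite \<Rightarrow> int ^ 'n \<Rightarrow> (real ^ 'n) set"
  where "lattice_box a b = cbox (real_vec a) (real_vec b)"

definition boxes_to_infinity :: "(real ^ 'n::finite) set filter"
  where "boxes_to_infinity =
    (INF K :: int. principal {lattice_box a b | a b. \<forall>i. a $ i \<le> - K \<and> K \<le> b $ i})"

lemma coord_V_box:
  "coord (blinfun_apply (V_box v (lattice_box a b)) u) n =
    (if real_vec (fst n) \<in> lattice_box a b then of_real (surface_potential v n) * coord u n else 0)"
proof -
  define F where "F = {x :: int ^ 'a. real_vec x \<in> lattice_box a b}"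
  have "finite F"
  proof (rule finite_imageD)
    show "finite (vec_nth ` F)"
      by (rule finite_subset[OF _ finite_PiE[of UNIV "\<lambda>i. {a $ i..b $ i}"]])
         (auto simp: F_def lattice_box_def real_vec_def mem_box_cart)
  qed (auto simp: inj_on_def vec_nth_inject)
  have "\<bar>if real_vec (fst n) \<in> lattice_box a b then surface_potential v n else 0\<bar> \<le> (\<Sum>x\<in>F. \<bar>v x\<bar>)"
    for n :: "('a, 'b) lattice"
    using member_le_sum[OF _ _ \<open>finite F\<close>, of "fst n" "\<lambda>x. \<bar>v x\<bar>"]
    by (auto simp: F_def surface_potential_def intro: sum_nonneg)
  then have "coord (blinfun_apply (V_box v (lattice_box a b)) u) n =
      of_real (if real_vec (fst n) \<in> lattice_box a b then surface_potential v n else 0) * coord u n"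
    unfolding V_box_def by (rule coord_mult_op)
  then show ?thesis
    by simp
qed


section \<open>Metrically transitive random fields\<close>

text \<open>
  Ergodicity is that of the whole family \<open>T\<close>: events invariant under every \<open>T k\<close> are trivial.
\<close>

definition metrically_transitive :: "'w measure \<Rightarrow> ('w \<Rightarrow> int ^ 'n::finite \<Rightarrow> real) \<Rightarrow> bool"
  where "metrically_transitive M V \<longleftrightarrow>
    prob_space M \<and>
    (\<forall>j. (\<lambda>\<omega>. V \<omega> j) \<in> borel_measurable M) \<and>
    (\<exists>T :: int ^ 'n \<Rightarrow> 'w \<Rightarrow> 'w.
      (\<forall>k. T k \<in> measurable M M \<and> distr M M (T k) = M) \<and>
      (\<forall>E\<in>sets M. (\<forall>k. T k -` E \<inter> space M = E) \<longrightarrow> measure M E = 0 \<or> measure M E = 1) \<and>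
      (\<forall>\<omega>\<in>space M. \<forall>k j. V (T k \<omega>) j = V \<omega> (j - k)))"


section \<open>Signed Borel measures\<close>

text \<open>
  A signed Borel measure on the line that is finite on bounded Borel sets is represented by its
  Jordan decomposition \<open>(\<Xi>\<^sup>+, \<Xi>\<^sup>-)\<close>. Both parts may have infinite total mass, so that the value
  of \<open>\<Xi>\<close> is only meaningful on bounded sets. Absolute continuity is that of
  \<open>|\<Xi>| = \<Xi>\<^sup>+ + \<Xi>\<^sup>-\<close>.
\<close>

type_synonym signed_measure = "real measure \<times> real measure"

definition signed_borel_measure :: "signed_measure \<Rightarrow> bool"
  where "signed_borel_measure \<Xi> \<longleftrightarrow>
    sets (fst \<Xi>) = sets borel \<and> sets (snd \<Xi>) = sets borel \<and>
    (\<forall>B\<in>sets borel. bounded B \<longrightarrow> emeasure (fst \<Xi>) B < \<infinity> \<and> emeasure (snd \<Xi>) B < \<infinity>) \<and>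
    (\<exists>S\<in>sets borel. emeasure (fst \<Xi>) (- S) = 0 \<and> emeasure (snd \<Xi>) S = 0)"

definition signed_integral :: "signed_measure \<Rightarrow> (real \<Rightarrow> real) \<Rightarrow> real"
  where "signed_integral \<Xi> g = (\<integral>t. g t \<partial>fst \<Xi>) - (\<integral>t. g t \<partial>snd \<Xi>)"

definition signed_absolutely_continuous :: "real measure \<Rightarrow> signed_measure \<Rightarrow> bool"
  where "signed_absolutely_continuous M \<Xi> \<longleftrightarrow>
    absolutely_continuous M (fst \<Xi>) \<and> absolutely_continuous M (snd \<Xi>)"

end

theory Submission
  imports Defs
begin

text \<open>
  A perturbation \<open>C\<close> of rank \<open>N\<close> moves the eigenvalue counting function of a finite symmetric matrix
  by at most \<open>N\<close>, so the trace of \<open>p(A + C) - p(A)\<close> is at most \<open>N \<integral> |p'|\<close> for every polynomial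
  \<open>p\<close>. As \<open>h0\<close> has finite range, this trace is the same on the whole lattice and on a large finite
  part of it, and approximation by polynomials gives \<open>|\<integral> g \<xi>| \<le> (N + 1) \<integral> |g|\<close>. For the potential of a
  box \<open>N\<close> is comparable to the volume of the box, so \<open>|\<integral> g d\<Xi>| \<le> K \<integral> |g|\<close> for a constant \<open>K\<close>.
\<close>

section \<open>Symmetric maps on finite-dimensional subspaces\<close>

text \<open>The bound must not involve the L1 norm of \<open>\<xi>\<close>, which may grow with the
  size of the potential: only the rank is divided out by the volume of a box. The obstacle is that
  the trace formula admits compactly supported \<open>\<phi>\<close> only, while rank bounds are
  available for polynomials. A polynomial is therefore multiplied by a cutoff equal to 1 on an
  interval that contains both spectra. The operators do not see the cutoff, but \<open>\<xi>\<close>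
  does, since nothing is known in advance about its support. The summand 1 in \<open>N + 1\<close>
  pays for this: the derivative of the cutoff is bounded independently of the interval, and the
  interval is chosen so long that this bound times the tail of \<open>\<xi>\<close> is at most 1.
  The polynomial itself is under control there, because it is an antiderivative vanishing at the
  left end. In the last step the estimate for \<open>\<Xi>\<close> is tested on compact null sets
  carried by one of the two Jordan parts.\<close>

definition orthonormal :: "'a::real_inner set \<Rightarrow> bool"
  where "orthonormal E \<longleftrightarrow> finite E \<and> (\<forall>x\<in>E. \<forall>y\<in>E. x \<bullet> y = (if x = y then 1 else 0))"

definition projection :: "'a::real_inner set \<Rightarrow> 'a \<Rightarrow> 'a"
  where "projection E x = (\<Sum>e\<in>E. (e \<bullet> x) *\<^sub>R e)"

lemma orthonormal_finite: "orthonormal E \<Longrightarrow> finite E"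
  by (simp add: orthonormal_def)

lemma projection_in_span: "projection E x \<in> span E"
  unfolding projection_def by (intro span_sum span_scale span_base)

lemma inner_projection:
  assumes "orthonormal E" "e \<in> E"
  shows "e \<bullet> projection E x = e \<bullet> x"
proof -
  have "e \<bullet> projection E x = (\<Sum>e'\<in>E. if e = e' then e \<bullet> x else 0)"
    unfolding projection_def inner_sum_right
    using assms by (intro sum.cong) (auto simp: orthonormal_def)
  then show ?thesis
    using assms by (simp add: orthonormal_def)
qed

text \<open>The difference lies in \<open>span E\<close> and is orthogonal to \<open>E\<close>,
  hence to itself.\<close>

lemma span_eqI_inner:
  assumes "orthonormal E" "x \<in> span E" "y \<in> span E" "\<And>e. e \<in> E \<Longrightarrow> e \<bullet> x = e \<bullet> y"
  shows "x = y"
proof -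
  have "x - y \<in> span E"
    using assms(2,3) by (rule span_diff)
  moreover have "orthogonal (x - y) e" if "e \<in> E" for e
    using assms(4)[OF that]
    by (simp only: orthogonal_def inner_diff_left inner_commute[of x] inner_commute[of y] diff_self)
  ultimately have "orthogonal (x - y) (x - y)"
    by (rule orthogonal_to_span)
  then show ?thesis
    by (simp add: orthogonal_self)
qed

lemma projection_id:
  assumes "orthonormal E" "x \<in> span E"
  shows "projection E x = x"
  by (rule span_eqI_inner[OF assms(1) projection_in_span assms(2)])
     (rule inner_projection[OF assms(1)])

text \<open>\<open>projection E x - x\<close> is orthogonal to \<open>E\<close> and so to its span.
  This is what gives a compression the same quadratic form as the operator.\<close>

lemma inner_projection_span:
  assumes "orthonormal E" "y \<in> span E"
  shows "y \<bullet> projection E x = y \<bullet> x"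
proof -
  have "orthogonal (projection E x - x) e" if "e \<in> E" for e
    using inner_projection[OF assms(1) that, of x]
    by (simp only: orthogonal_def inner_diff_left inner_commute[of x e] inner_commute[of "projection E x"] diff_self)
  then have "orthogonal (projection E x - x) y"
    by (rule orthogonal_to_span[OF assms(2)])
  then show ?thesis
    by (simp add: orthogonal_def inner_diff_left inner_diff_right inner_commute)
qed

lemma bounded_linear_projection: "bounded_linear (projection E)"
  unfolding projection_def[abs_def]
  by (intro bounded_linear_sum bounded_linear_scaleR_const bounded_linear_inner_right)

lemma inner_orthonormal_expansion:
  assumes "orthonormal E" "x \<in> span E"
  shows "y \<bullet> x = (\<Sum>e\<in>E. (e \<bullet> x) * (y \<bullet> e))"
proof -
  have "y \<bullet> x = y \<bullet> projection E x"
    by (simp add: projection_id[OF assms])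
  then show ?thesis
    by (simp add: projection_def inner_sum_right)
qed

lemma norm_orthonormal_expansion:
  assumes "orthonormal E" "x \<in> span E"
  shows "(norm x)\<^sup>2 = (\<Sum>e\<in>E. (e \<bullet> x)\<^sup>2)"
  unfolding power2_norm_eq_inner inner_orthonormal_expansion[OF assms, of x]
  by (simp add: power2_eq_square inner_commute)

lemma orthonormal_independent: "orthonormal E \<Longrightarrow> independent E"
  by (rule pairwise_orthogonal_independent)
     (auto simp: orthonormal_def pairwise_def orthogonal_def dest!: bspec[of _ _ 0])

lemma orthonormal_card_le:
  assumes "orthonormal B" "B \<subseteq> span E" "finite E"
  shows "card B \<le> card E"
  using independent_span_bound[OF assms(3) orthonormal_independent[OF assms(1)] assms(2)] by simp

lemma orthonormal_basis_exists:
  fixes X :: "'a::real_inner set"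
  assumes "finite X"
  shows "\<exists>E. orthonormal E \<and> span E = span X"
proof -
  obtain C where C: "finite C" "span C = span X" "pairwise orthogonal C"
    using basis_orthogonal[OF assms] by blast
  \<comment> \<open>The orthogonal set \<open>C\<close> may contain 0, which cannot be
    normalised.\<close>
  define E where "E = (\<lambda>c. c /\<^sub>R norm c) ` (C - {0})"
  have "span E = span (C - {0})"
    unfolding E_def
    by (rule span_image_scale) (use C in auto)
  moreover have "orthonormal E"
    unfolding orthonormal_def
  proof (intro conjI ballI)
    show "finite E" using C by (simp add: E_def)
    fix x y assume "x \<in> E" "y \<in> E"
    then obtain c d where c: "c \<in> C" "c \<noteq> 0" "x = c /\<^sub>R norm c"
      and d: "d \<in> C" "d \<noteq> 0" "y = d /\<^sub>R norm d"
      by (auto simp: E_def)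
    show "x \<bullet> y = (if x = y then 1 else 0)"
    proof (cases "c = d")
      case True
      then show ?thesis using c d by (simp add: norm_eq_sqrt_inner field_simps)
    next
      case False
      then have "x \<bullet> y = 0"
        using C(3) c d by (auto simp: pairwise_def orthogonal_def)
      moreover have "x \<noteq> 0" using c by simp
      then have "x \<bullet> x \<noteq> 0" by simp
      then have "x \<noteq> y"
        using \<open>x \<bullet> y = 0\<close> by metis
      ultimately show ?thesis by simp
    qed
  qed
  ultimately show ?thesis
    using C by auto
qed

text \<open>The ambient space may be infinite-dimensional, so compactness has to come from the
  finitely many coefficients: the set for \<open>insert x E\<close> is a continuous image of an
  interval times the set for \<open>E\<close>.\<close>

lemma compact_bounded_combinations:
  fixes E :: "'a::real_normed_vector set"
  assumes "finite E"
  shows "compact {(\<Sum>e\<in>E. c e *\<^sub>R e) | c :: 'a \<Rightarrow> real. \<forall>e\<in>E. \<bar>c e\<bar> \<le> r}"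
  using assms
proof (induction E)
  case empty
  have "{(\<Sum>e\<in>{}. c e *\<^sub>R e) | c :: 'a \<Rightarrow> real. \<forall>e\<in>{}. \<bar>c e\<bar> \<le> r} = {0}" by auto
  then show ?case by (simp only: compact_sing)
next
  case (insert x E)
  let ?K = "\<lambda>E. {(\<Sum>e\<in>E. c e *\<^sub>R e) | c :: 'a \<Rightarrow> real. \<forall>e\<in>E. \<bar>c e\<bar> \<le> r}"
  have "compact ((\<lambda>p. fst p *\<^sub>R x + snd p) ` ({-r..r} \<times> ?K E))"
    by (intro compact_continuous_image compact_Times insert.IH continuous_intros compact_Icc)
  also have "(\<lambda>p. fst p *\<^sub>R x + snd p) ` ({-r..r} \<times> ?K E) = ?K (insert x E)"
  proof (intro set_eqI iffI)
    fix y assume "y \<in> (\<lambda>p. fst p *\<^sub>R x + snd p) ` ({-r..r} \<times> ?K E)"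
    then obtain p where p: "p \<in> {-r..r} \<times> ?K E" "y = fst p *\<^sub>R x + snd p"
      by (rule imageE)
    define s where "s = fst p"
    from p(1) have "s \<in> {-r..r}" "snd p \<in> ?K E"
      by (simp_all only: s_def mem_Times_iff)
    then obtain c where c: "\<forall>e\<in>E. \<bar>c e\<bar> \<le> r" and "snd p = (\<Sum>e\<in>E. c e *\<^sub>R e)"
      by blast
    with p(2) have y: "y = s *\<^sub>R x + (\<Sum>e\<in>E. c e *\<^sub>R e)"
      by (simp add: s_def)
    have s: "\<bar>s\<bar> \<le> r" using \<open>s \<in> {-r..r}\<close> by (simp add: abs_le_iff)
    have "y = (\<Sum>e\<in>insert x E. (c(x := s)) e *\<^sub>R e)"
      using insert.hyps by (auto simp: y intro!: sum.cong)
    then show "y \<in> ?K (insert x E)"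
      using s c by (auto intro!: exI[of _ "c(x := s)"])
  next
    fix y assume "y \<in> ?K (insert x E)"
    then obtain c where "\<forall>e\<in>insert x E. \<bar>c e\<bar> \<le> r" "y = (\<Sum>e\<in>insert x E. c e *\<^sub>R e)" by auto
    then show "y \<in> (\<lambda>p. fst p *\<^sub>R x + snd p) ` ({-r..r} \<times> ?K E)"
      using insert.hyps by (auto intro!: image_eqI[of _ _ "(c x, \<Sum>e\<in>E. c e *\<^sub>R e)"])
  qed
  finally show ?case .
qed

text \<open>The eigenvector maximises the quadratic form of \<open>f\<close> on the unit sphere.\<close>

lemma symmetric_eigenvector_exists:
  fixes f :: "'a::real_inner \<Rightarrow> 'a"
  assumes E: "orthonormal E" and f: "bounded_linear f"
    and sym: "\<And>x y. x \<in> span E \<Longrightarrow> y \<in> span E \<Longrightarrow> x \<bullet> f y = f x \<bullet> y"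
    and U: "U = {x \<in> span E. \<forall>b\<in>B. b \<bullet> x = 0}"
    and inv: "\<And>x. x \<in> U \<Longrightarrow> f x \<in> U"
    and ne: "z \<in> U" "z \<noteq> 0"
  shows "\<exists>x\<in>U. norm x = 1 \<and> f x = (x \<bullet> f x) *\<^sub>R x"
proof -
  interpret f: bounded_linear f by (rule f)
  let ?K = "{(\<Sum>e\<in>E. c e *\<^sub>R e) | c :: 'a \<Rightarrow> real. \<forall>e\<in>E. \<bar>c e\<bar> \<le> 1}"
  \<comment> \<open>The coefficients of a unit vector in an orthonormal basis are at most 1 in
    modulus, so this is the unit sphere of \<open>U\<close>, written as a closed part of a compact
    set.\<close>
  define S where "S = ?K \<inter> {x. norm x = 1} \<inter> (\<Inter>b\<in>B. {x. b \<bullet> x = 0})"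
  have S: "S = {x \<in> U. norm x = 1}"
  proof (intro set_eqI iffI)
    fix x assume "x \<in> {x \<in> U. norm x = 1}"
    then have x: "x \<in> span E" "norm x = 1" "\<forall>b\<in>B. b \<bullet> x = 0" by (auto simp: U)
    have "\<bar>e \<bullet> x\<bar> \<le> 1" if "e \<in> E" for e
    proof -
      have "norm e = 1" using E that by (auto simp: orthonormal_def norm_eq_sqrt_inner)
      then show ?thesis using Cauchy_Schwarz_ineq2[of e x] x by simp
    qed
    moreover have "x = (\<Sum>e\<in>E. (e \<bullet> x) *\<^sub>R e)"
      using projection_id[OF E x(1)] by (simp add: projection_def)
    ultimately show "x \<in> S" using x by (auto simp: S_def)
  qed (auto simp: S_def U intro!: span_sum span_scale intro: span_base)
  have "compact S"
    unfolding S_def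
    by (intro compact_Int_closed compact_bounded_combinations orthonormal_finite[OF E]
        closed_INT ballI closed_Collect_eq continuous_intros)
  moreover have "z /\<^sub>R norm z \<in> S"
    using ne by (auto simp: S U span_scale)
  then have "S \<noteq> {}" by blast
  moreover have "continuous_on S (\<lambda>x. x \<bullet> f x)"
    by (intro continuous_intros f.continuous_on)
  ultimately obtain x where x: "x \<in> S" and max: "\<And>y. y \<in> S \<Longrightarrow> y \<bullet> f y \<le> x \<bullet> f x"
    using continuous_attains_sup by meson
  define \<mu> where "\<mu> = x \<bullet> f x"
  \<comment> \<open>\<open>Q\<close> is nonnegative on \<open>U\<close> and vanishes at the
    maximiser \<open>x\<close>, so its first variation at \<open>x\<close> is zero in every
    direction of \<open>U\<close>.\<close>
  define Q where "Q y = \<mu> * (y \<bullet> y) - y \<bullet> f y" for y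
  have xU: "x \<in> U" "norm x = 1" using x S by auto
  have UE: "y \<in> span E" if "y \<in> U" for y using that U by auto
  have Usub: "c *\<^sub>R y + d *\<^sub>R y' \<in> U" if "y \<in> U" "y' \<in> U" for c d y y'
    using that by (auto simp: U span_add span_scale inner_add_right)
  have Q: "0 \<le> Q y" if "y \<in> U" for y
  proof (cases "y = 0")
    case False
    have "y /\<^sub>R norm y \<in> S"
      using False that by (auto simp: S U span_scale)
    from max[OF this] have "(y \<bullet> f y) / (norm y)\<^sup>2 \<le> \<mu>"
      by (simp add: f.scaleR \<mu>_def power2_eq_square field_simps)
    then show ?thesis
      using False by (simp add: Q_def power2_norm_eq_inner[symmetric] field_simps)
  qed (simp add: Q_def)
  have lin: "y \<bullet> (\<mu> *\<^sub>R x - f x) = 0" if y: "y \<in> U" for y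
  proof (rule ccontr)
    define k where "k = y \<bullet> (\<mu> *\<^sub>R x - f x)"
    assume "y \<bullet> (\<mu> *\<^sub>R x - f x) \<noteq> 0"
    then have k0: "k \<noteq> 0" by (simp add: k_def)
    have exp: "Q (x + s *\<^sub>R y) = 2 * s * k + s\<^sup>2 * Q y" for s
    proof -
      have "x \<bullet> f y = y \<bullet> f x"
        using sym[OF UE[OF xU(1)] UE[OF y]] by (simp add: inner_commute)
      moreover have "x \<bullet> x = 1" using xU by (simp add: power2_norm_eq_inner[symmetric])
      ultimately show ?thesis
        unfolding Q_def k_def by (simp add: f.add f.scaleR \<mu>_def algebra_simps power2_eq_square inner_commute)
    qed
    have "0 \<le> 2 * s * k + s\<^sup>2 * Q y" for s
      using Q[OF Usub[OF xU(1) y, of 1 s]] exp[of s] by simp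
    \<comment> \<open>This \<open>s\<close> turns the linear term into
      \<open>- 2 * k\<^sup>2 / (Q y + 1)\<close>, while the quadratic term stays below
      \<open>k\<^sup>2 / (Q y + 1)\<close>. The summand 1 keeps the denominator positive when
      \<open>Q y = 0\<close>.\<close>
    from this[of "- k / (Q y + 1)"] have "0 \<le> - (2 * k\<^sup>2 / (Q y + 1)) + k\<^sup>2 * (Q y / (Q y + 1)\<^sup>2)"
      by (simp add: power2_eq_square)
    moreover have "Q y / (Q y + 1) * (1 / (Q y + 1)) \<le> 1 * (1 / (Q y + 1))"
      using Q[OF y] by (intro mult_right_mono) simp_all
    then have "Q y / (Q y + 1)\<^sup>2 \<le> 1 / (Q y + 1)"
      by (simp add: power2_eq_square)
    then have "k\<^sup>2 * (Q y / (Q y + 1)\<^sup>2) \<le> k\<^sup>2 * (1 / (Q y + 1))"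
      by (rule mult_left_mono) simp
    moreover have "0 < k\<^sup>2 * (1 / (Q y + 1))"
      using k0 Q[OF y] by (simp add: add_nonneg_pos)
    ultimately show False by (simp)
  qed
  have "\<mu> *\<^sub>R x - f x \<in> U"
    using Usub[OF xU(1) inv[OF xU(1)], of \<mu> "-1"] by simp
  \<comment> \<open>The residual belongs to \<open>U\<close> and is therefore orthogonal to
    itself.\<close>
  from lin[OF this] have "f x = \<mu> *\<^sub>R x" by simp
  then show ?thesis
    using xU by (auto simp: \<mu>_def)
qed

text \<open>An orthonormal set \<open>B\<close> of eigenvectors of maximal size must span: by
  symmetry \<open>f\<close> preserves the orthogonal complement of \<open>B\<close>, and an
  eigenvector found there would enlarge \<open>B\<close>.\<close>

theorem symmetric_eigenbasis:
  fixes f :: "'a::real_inner \<Rightarrow> 'a"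
  assumes E: "orthonormal E" and f: "bounded_linear f"
    and inv: "\<And>x. x \<in> span E \<Longrightarrow> f x \<in> span E"
    and sym: "\<And>x y. x \<in> span E \<Longrightarrow> y \<in> span E \<Longrightarrow> x \<bullet> f y = f x \<bullet> y"
  shows "\<exists>B. orthonormal B \<and> span B = span E \<and> (\<forall>b\<in>B. f b = (b \<bullet> f b) *\<^sub>R b)"
proof -
  define P where "P B \<longleftrightarrow> orthonormal B \<and> B \<subseteq> span E \<and> (\<forall>b\<in>B. f b = (b \<bullet> f b) *\<^sub>R b)" for B
  have "P {}" by (simp add: P_def orthonormal_def)
  moreover have "\<forall>B. P B \<longrightarrow> card B < Suc (card E)"
    using orthonormal_card_le[OF _ _ orthonormal_finite[OF E]] by (auto simp: P_def less_Suc_eq_le)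
  ultimately have "\<exists>B. P B \<and> (\<forall>B'. P B' \<longrightarrow> card B' \<le> card B)"
    by (rule ex_has_greatest_nat)
  then obtain B where B: "P B" and max: "\<And>B'. P B' \<Longrightarrow> card B' \<le> card B"
    by blast
  have oB: "orthonormal B" and BE: "B \<subseteq> span E" and eig: "\<And>b. b \<in> B \<Longrightarrow> f b = (b \<bullet> f b) *\<^sub>R b"
    using B by (auto simp: P_def)
  define U where "U = {x \<in> span E. \<forall>b\<in>B. b \<bullet> x = 0}"
  have U0: "z = 0" if "z \<in> U" for z
  proof (rule ccontr)
    assume "z \<noteq> 0"
    have "f x \<in> U" if "x \<in> U" for x
    proof -
      have "b \<bullet> f x = 0" if b: "b \<in> B" for b
      proof -
        have "b \<bullet> f x = f b \<bullet> x" using sym b BE \<open>x \<in> U\<close> by (auto simp: U_def)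
        also have "\<dots> = 0" using b \<open>x \<in> U\<close> by (subst eig) (auto simp: U_def)
        finally show ?thesis .
      qed
      then show ?thesis using inv \<open>x \<in> U\<close> by (auto simp: U_def)
    qed
    then obtain x where x: "x \<in> U" "norm x = 1" "f x = (x \<bullet> f x) *\<^sub>R x"
      using symmetric_eigenvector_exists[OF E f sym U_def _ \<open>z \<in> U\<close> \<open>z \<noteq> 0\<close>] by blast
    have xx: "x \<bullet> x = 1" using x by (simp add: power2_norm_eq_inner[symmetric])
    have "x \<notin> B" using x xx by (auto simp: U_def)
    have "P (insert x B)"
      using x xx \<open>x \<notin> B\<close> oB BE eig
      by (auto simp: P_def orthonormal_def U_def inner_commute)
    with max[OF this] \<open>x \<notin> B\<close> orthonormal_finite[OF oB] show False by simp
  qed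
  have "span B = span E"
  proof (intro equalityI subsetI)
    fix x assume "x \<in> span B"
    then show "x \<in> span E" using BE span_mono[OF BE] by (simp add: span_span subset_eq)
  next
    fix x assume x: "x \<in> span E"
    have "projection B x \<in> span E"
      using projection_in_span[of B x] span_mono[OF BE] by (auto simp: span_span)
    then have "x - projection B x \<in> U"
      using x inner_projection[OF oB, of _ x] by (auto simp: U_def span_diff inner_diff_right)
    from U0[OF this] show "x \<in> span B"
      using projection_in_span[of B x] by simp
  qed
  then show ?thesis using oB eig by blast
qed

text \<open>The projections of \<open>D\<close> to \<open>span U\<close> span a space of dimension
  less than \<open>card U\<close>, so some \<open>u\<close> in \<open>U\<close> lies outside it;
  subtracting its component in that space leaves the vector.\<close>

lemma orthogonal_vector_exists:
  fixes U :: "'a::real_inner set"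
  assumes U: "orthonormal U" and D: "finite D" "card D < card U"
  shows "\<exists>x\<in>span U. x \<noteq> 0 \<and> (\<forall>d\<in>D. d \<bullet> x = 0)"
proof -
  obtain C where C: "orthonormal C" "span C = span (projection U ` D)"
    using orthonormal_basis_exists[of "projection U ` D"] D by auto
  have "\<not> U \<subseteq> span C"
    using orthonormal_card_le[OF U, of "projection U ` D"] D card_image_le[OF D(1), of "projection U"]
    by (auto simp: C)
  then obtain u where u: "u \<in> U" "u \<notin> span C" by blast
  define x where "x = u - projection C u"
  have "span C \<subseteq> span U"
    unfolding C(2) by (rule span_minimal) (auto simp: projection_in_span)
  then have xU: "x \<in> span U"
    using u projection_in_span[of C u] by (auto simp: x_def intro: span_diff span_base)
  have "x \<noteq> 0"
    using u projection_in_span[of C u] by (auto simp: x_def)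
  moreover have "d \<bullet> x = 0" if "d \<in> D" for d
  proof -
    have "d \<bullet> x = x \<bullet> projection U d"
      using inner_projection_span[OF U xU] by (simp add: inner_commute)
    also have "\<dots> = projection U d \<bullet> u - projection U d \<bullet> projection C u"
      by (simp add: x_def inner_diff_left inner_diff_right inner_commute[of _ "projection U d"])
    also have "projection U d \<in> span C"
      using that unfolding C(2) by (intro span_base) auto
    then have "projection U d \<bullet> projection C u = projection U d \<bullet> u"
      by (rule inner_projection_span[OF C(1)])
    finally show ?thesis by simp
  qed
  ultimately show ?thesis using xU by blast
qed

section \<open>Trace of a difference of polynomials\<close>

text \<open>The pointwise counterpart of \<open>poly_op\<close>: the compressions used later are
  plain functions, not elements of the type of bounded operators.\<close>

definition poly_map :: "real poly \<Rightarrow> ('a::real_vector \<Rightarrow> 'a) \<Rightarrow> 'a \<Rightarrow> 'a"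
  where "poly_map p f x = (\<Sum>k\<le>degree p. coeff p k *\<^sub>R (f ^^ k) x)"

lemma poly_op_apply: "blinfun_apply (poly_op p A) x = poly_map p (blinfun_apply A) x"
proof -
  have "blinfun_apply (((\<lambda>B. A o\<^sub>L B) ^^ k) id_blinfun) x = (blinfun_apply A ^^ k) x" for k
    by (induction k) auto
  then show ?thesis
    by (simp add: poly_op_def poly_map_def blinfun.sum_left blinfun.scaleR_left)
qed

lemma poly_map_cong:
  "(\<And>k. k \<le> degree p \<Longrightarrow> (f ^^ k) x = (g ^^ k) x) \<Longrightarrow> poly_map p f x = poly_map p g x"
  unfolding poly_map_def by (intro sum.cong) auto

lemma linear_funpow:
  fixes f :: "'a::real_vector \<Rightarrow> 'a"
  shows "linear f \<Longrightarrow> linear (f ^^ k)"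
proof (induction k)
  case 0
  show ?case by (auto intro!: linearI)
next
  case (Suc k)
  then show ?case by (simp add: linear_compose del: comp_apply)
qed

lemma linear_poly_map: "linear f \<Longrightarrow> linear (poly_map p f)"
  unfolding poly_map_def[abs_def]
  by (intro linear_compose_sum ballI linear_compose_scale_right linear_funpow)

lemma poly_map_eigenvector:
  assumes "linear f" "f x = r *\<^sub>R x"
  shows "poly_map p f x = poly p r *\<^sub>R x"
proof -
  have "(f ^^ k) x = r ^ k *\<^sub>R x" for k
    by (induction k) (simp_all add: assms linear_scale mult.commute)
  then show ?thesis
    by (simp add: poly_map_def poly_altdef scaleR_sum_left)
qed

section \<open>Quadratic forms, traces and eigenvalue counts in an eigenbasis\<close>

lemma quadratic_form_eigenbasis:
  assumes "orthonormal B" "x \<in> span B" "linear f" "\<And>b. b \<in> B \<Longrightarrow> f b = r b *\<^sub>R b"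
  shows "x \<bullet> f x = (\<Sum>b\<in>B. r b * (b \<bullet> x)\<^sup>2)"
proof -
  have "f x = f (projection B x)"
    by (simp add: projection_id[OF assms(1,2)])
  also have "\<dots> = (\<Sum>b\<in>B. (b \<bullet> x) *\<^sub>R (r b *\<^sub>R b))"
    unfolding projection_def linear_sum[OF assms(3)] linear_scale[OF assms(3)]
    by (intro sum.cong) (simp_all add: assms(4))
  finally show ?thesis
    by (simp add: inner_sum_right power2_eq_square inner_commute algebra_simps)
qed

text \<open>Each \<open>e\<close> is expanded in \<open>B\<close> and, after exchanging the sums,
  each \<open>b\<close> in \<open>E\<close>.\<close>

lemma trace_orthonormal_basis_independent:
  assumes E: "orthonormal E" and B: "orthonormal B" and EB: "span B = span E" and f: "linear f"
  shows "(\<Sum>e\<in>E. e \<bullet> f e) = (\<Sum>b\<in>B. b \<bullet> f b)"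
proof -
  have "(\<Sum>e\<in>E. e \<bullet> f e) = (\<Sum>e\<in>E. \<Sum>b\<in>B. (b \<bullet> e) * (e \<bullet> f b))"
  proof (rule sum.cong[OF refl])
    fix e assume "e \<in> E"
    then have "e \<in> span B" by (simp add: EB span_base)
    then have "f e = f (projection B e)"
      by (simp add: projection_id[OF B])
    also have "\<dots> = (\<Sum>b\<in>B. (b \<bullet> e) *\<^sub>R f b)"
      by (simp add: projection_def linear_sum[OF f] linear_scale[OF f])
    finally show "e \<bullet> f e = (\<Sum>b\<in>B. (b \<bullet> e) * (e \<bullet> f b))"
      by (simp add: inner_sum_right)
  qed
  also have "\<dots> = (\<Sum>b\<in>B. \<Sum>e\<in>E. (e \<bullet> b) * (f b \<bullet> e))"
    by (subst sum.swap) (simp add: inner_commute)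
  also have "\<dots> = (\<Sum>b\<in>B. b \<bullet> f b)"
  proof (rule sum.cong[OF refl])
    fix b assume "b \<in> B"
    then have "b \<in> span E" by (simp add: EB[symmetric] span_base)
    from inner_orthonormal_expansion[OF E this, of "f b"]
    show "(\<Sum>e\<in>E. (e \<bullet> b) * (f b \<bullet> e)) = b \<bullet> f b"
      by (simp add: inner_commute)
  qed
  finally show ?thesis .
qed

text \<open>The min-max argument. If the count for \<open>f\<close> were larger, the span of its
  eigenvectors up to level \<open>t\<close> would contain a nonzero \<open>x\<close> orthogonal to
  \<open>D\<close> and to the eigenvectors of \<open>g\<close> up to level \<open>t\<close>. The
  form of \<open>f\<close> at \<open>x\<close> is then at most \<open>t * (norm x)\<^sup>2\<close>,
  that of \<open>g\<close> is larger, yet the two agree at \<open>x\<close>.\<close>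

lemma eigenvalue_count_le:
  fixes f g :: "'a::real_inner \<Rightarrow> 'a"
  assumes B: "orthonormal B" "linear f" "\<And>b. b \<in> B \<Longrightarrow> f b = r b *\<^sub>R b"
    and C: "orthonormal C" "linear g" "\<And>c. c \<in> C \<Longrightarrow> g c = s c *\<^sub>R c"
    and BC: "span B = span C"
    and D: "finite D" "\<And>x. x \<in> span B \<Longrightarrow> (\<And>d. d \<in> D \<Longrightarrow> d \<bullet> x = 0) \<Longrightarrow> x \<bullet> f x = x \<bullet> g x"
  shows "card {b \<in> B. r b \<le> t} \<le> card {c \<in> C. s c \<le> t} + card D"
proof (rule ccontr)
  define U where "U = {b \<in> B. r b \<le> t}"
  define W where "W = {c \<in> C. s c \<le> t} \<union> D"
  assume "\<not> ?thesis"
  then have "card W < card U"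
    using card_Un_le[of "{c \<in> C. s c \<le> t}" D] by (simp add: U_def W_def)
  moreover have U: "orthonormal U" and UB: "U \<subseteq> B"
    using B(1) by (auto simp: U_def orthonormal_def)
  moreover have "finite W"
    using D(1) orthonormal_finite[OF C(1)] by (simp add: W_def)
  ultimately obtain x where x: "x \<in> span U" "x \<noteq> 0" and orth: "\<And>d. d \<in> W \<Longrightarrow> d \<bullet> x = 0"
    using orthogonal_vector_exists[of U W] by blast
  have xB: "x \<in> span B" using x(1) span_mono[OF UB] by blast
  then have xC: "x \<in> span C" by (simp add: BC)
  have "x \<bullet> f x = (\<Sum>b\<in>U. r b * (b \<bullet> x)\<^sup>2)"
    using UB by (intro quadratic_form_eigenbasis U x B) auto
  also have "\<dots> \<le> (\<Sum>b\<in>U. t * (b \<bullet> x)\<^sup>2)"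
    by (intro sum_mono mult_right_mono) (auto simp: U_def)
  also have "\<dots> = t * (norm x)\<^sup>2"
    by (simp add: norm_orthonormal_expansion[OF U x(1)] sum_distrib_left)
  finally have le: "x \<bullet> f x \<le> t * (norm x)\<^sup>2" .
  have nz: "c \<bullet> x = 0" if "c \<in> C" "s c \<le> t" for c
    using orth[of c] that by (simp add: W_def)
  have "\<exists>c\<in>C. c \<bullet> x \<noteq> 0"
  proof (rule ccontr)
    assume "\<not> (\<exists>c\<in>C. c \<bullet> x \<noteq> 0)"
    then have "(norm x)\<^sup>2 = 0"
      unfolding norm_orthonormal_expansion[OF C(1) xC] by simp
    with x(2) show False by simp
  qed
  then obtain c where c: "c \<in> C" "c \<bullet> x \<noteq> 0" by blast
  have "t * (norm x)\<^sup>2 = (\<Sum>c\<in>C. t * (c \<bullet> x)\<^sup>2)"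
    by (simp add: norm_orthonormal_expansion[OF C(1) xC] sum_distrib_left)
  \<comment> \<open>Only coefficients with \<open>s c > t\<close> survive, and at least one of them
    is nonzero; this gives strictness.\<close>
  also have "\<dots> < (\<Sum>c\<in>C. s c * (c \<bullet> x)\<^sup>2)"
  proof (rule sum_strict_mono_ex1)
    show "finite C" using C(1) by (rule orthonormal_finite)
    show "\<forall>c\<in>C. t * (c \<bullet> x)\<^sup>2 \<le> s c * (c \<bullet> x)\<^sup>2"
    proof
      fix c assume "c \<in> C"
      then show "t * (c \<bullet> x)\<^sup>2 \<le> s c * (c \<bullet> x)\<^sup>2"
        using nz[of c] by (cases "s c \<le> t") (auto intro!: mult_right_mono)
    qed
    show "\<exists>c\<in>C. t * (c \<bullet> x)\<^sup>2 < s c * (c \<bullet> x)\<^sup>2"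
      using c nz[of c] by (intro bexI[of _ c] mult_strict_right_mono) (auto simp: not_le[symmetric])
  qed
  also have "\<dots> = x \<bullet> g x"
    using quadratic_form_eigenbasis[OF C(1) xC C(2), of s] C(3) by simp
  also have "\<dots> = x \<bullet> f x"
    using D(2)[OF xB] orth by (simp add: W_def)
  finally show False using le by simp
qed

text \<open>\<open>poly p R - poly p (r b)\<close> is the integral of the derivative from
  \<open>r b\<close> to \<open>R\<close>. Summation over \<open>b\<close> turns the indicators of
  these intervals into the counting function.\<close>

lemma sum_poly_eigenvalues:
  fixes r :: "'b \<Rightarrow> real"
  assumes "finite B" "\<And>b. b \<in> B \<Longrightarrow> \<bar>r b\<bar> \<le> R"
  shows "has_bochner_integral lborel
    (\<lambda>t. poly (pderiv p) t * indicator {-R..R} t * real (card {b \<in> B. r b \<le> t}))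
    (real (card B) * poly p R - (\<Sum>b\<in>B. poly p (r b)))"
proof -
  have "has_bochner_integral lborel (\<lambda>t. poly (pderiv p) t * indicator {r b..R} t)
      (poly p R - poly p (r b))" if "b \<in> B" for b
    using assms(2)[OF that]
    by (intro has_bochner_integral_FTC_Icc_real) (auto intro!: poly_DERIV continuous_intros)
  then have "has_bochner_integral lborel
      (\<lambda>t. \<Sum>b\<in>B. poly (pderiv p) t * indicator {r b..R} t) (\<Sum>b\<in>B. poly p R - poly p (r b))"
    by (rule has_bochner_integral_sum)
  also have "(\<lambda>t. \<Sum>b\<in>B. poly (pderiv p) t * indicator {r b..R} t) =
      (\<lambda>t. poly (pderiv p) t * indicator {-R..R} t * real (card {b \<in> B. r b \<le> t}))"
  proof
    fix t
    have "(\<Sum>b\<in>B. poly (pderiv p) t * indicator {r b..R} t) =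
        (\<Sum>b\<in>B. poly (pderiv p) t * indicator {-R..R} t * (if r b \<le> t then 1 else 0))"
      using assms(2) by (intro sum.cong) (force simp: indicator_def abs_le_iff)+
    also have "\<dots> = poly (pderiv p) t * indicator {-R..R} t * real (card {b \<in> B. r b \<le> t})"
      unfolding sum_distrib_left[symmetric] using assms(1)
      by (simp add: sum.If_cases Int_def)
    finally show "(\<Sum>b\<in>B. poly (pderiv p) t * indicator {r b..R} t) =
      poly (pderiv p) t * indicator {-R..R} t * real (card {b \<in> B. r b \<le> t})" .
  qed
  finally show ?thesis
    by (simp add: sum_subtractf)
qed

text \<open>When \<open>sum_poly_eigenvalues\<close> is applied to \<open>f\<close> and
  \<open>g\<close>, the terms with \<open>poly p R\<close> cancel, since both eigenbases have the
  same size. The trace difference is the integral of the derivative against a difference of counting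
  functions, a finite-dimensional spectral shift function of modulus at most
  \<open>card D\<close>.\<close>

theorem trace_difference_bound:
  fixes f g :: "'a::real_inner \<Rightarrow> 'a"
  assumes E: "orthonormal E"
    and f: "bounded_linear f" "\<And>x. x \<in> span E \<Longrightarrow> f x \<in> span E"
      "\<And>x y. x \<in> span E \<Longrightarrow> y \<in> span E \<Longrightarrow> x \<bullet> f y = f x \<bullet> y"
      "\<And>x. x \<in> span E \<Longrightarrow> norm x = 1 \<Longrightarrow> \<bar>x \<bullet> f x\<bar> \<le> R"
    and g: "bounded_linear g" "\<And>x. x \<in> span E \<Longrightarrow> g x \<in> span E"
      "\<And>x y. x \<in> span E \<Longrightarrow> y \<in> span E \<Longrightarrow> x \<bullet> g y = g x \<bullet> y"
      "\<And>x. x \<in> span E \<Longrightarrow> norm x = 1 \<Longrightarrow> \<bar>x \<bullet> g x\<bar> \<le> R"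
    and D: "finite D" "\<And>x. x \<in> span E \<Longrightarrow> (\<And>d. d \<in> D \<Longrightarrow> d \<bullet> x = 0) \<Longrightarrow> x \<bullet> f x = x \<bullet> g x"
  shows "\<bar>(\<Sum>e\<in>E. e \<bullet> poly_map p f e) - (\<Sum>e\<in>E. e \<bullet> poly_map p g e)\<bar>
    \<le> real (card D) * (\<integral>t. \<bar>poly (pderiv p) t\<bar> * indicator {-R..R} t \<partial>lborel)"
proof -
  obtain B where B: "orthonormal B" "span B = span E" and eB: "\<And>b. b \<in> B \<Longrightarrow> f b = (b \<bullet> f b) *\<^sub>R b"
    using symmetric_eigenbasis[OF E f(1-3)] by blast
  obtain C where C: "orthonormal C" "span C = span E" and eC: "\<And>c. c \<in> C \<Longrightarrow> g c = (c \<bullet> g c) *\<^sub>R c"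
    using symmetric_eigenbasis[OF E g(1-3)] by blast
  have lin: "linear f" "linear g"
    using f(1) g(1) by (auto intro: bounded_linear.linear)
  have fin: "finite B" "finite C"
    using B C by (auto intro: orthonormal_finite)
  define n where "n t = real (card {b \<in> B. b \<bullet> f b \<le> t})" for t
  define m where "m t = real (card {c \<in> C. c \<bullet> g c \<le> t})" for t
  have unit: "norm x = 1" if "x \<in> X" "orthonormal X" for x :: 'a and X
    using that by (auto simp: orthonormal_def norm_eq_sqrt_inner)
  have BC: "card B = card C"
    using orthonormal_card_le[OF B(1) _ fin(2)] orthonormal_card_le[OF C(1) _ fin(1)]
      span_superset[of B] span_superset[of C] B C by (metis le_antisym)
  have trf: "(\<Sum>e\<in>E. e \<bullet> poly_map p f e) = (\<Sum>b\<in>B. poly p (b \<bullet> f b))"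
  proof -
    have "(\<Sum>e\<in>E. e \<bullet> poly_map p f e) = (\<Sum>b\<in>B. b \<bullet> poly_map p f b)"
      by (rule trace_orthonormal_basis_independent[OF E B linear_poly_map[OF lin(1)]])
    also have "\<dots> = (\<Sum>b\<in>B. poly p (b \<bullet> f b))"
      using B(1) by (intro sum.cong refl, subst poly_map_eigenvector[OF lin(1) eB])
        (auto simp: orthonormal_def)
    finally show ?thesis .
  qed
  have trg: "(\<Sum>e\<in>E. e \<bullet> poly_map p g e) = (\<Sum>b\<in>C. poly p (b \<bullet> g b))"
  proof -
    have "(\<Sum>e\<in>E. e \<bullet> poly_map p g e) = (\<Sum>b\<in>C. b \<bullet> poly_map p g b)"
      by (rule trace_orthonormal_basis_independent[OF E C linear_poly_map[OF lin(2)]])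
    also have "\<dots> = (\<Sum>b\<in>C. poly p (b \<bullet> g b))"
      using C(1) by (intro sum.cong refl, subst poly_map_eigenvector[OF lin(2) eC])
        (auto simp: orthonormal_def)
    finally show ?thesis .
  qed
  have "\<bar>b \<bullet> f b\<bar> \<le> R" if "b \<in> B" for b
    using f(4)[of b] that B unit[OF that B(1)] span_base[of b B] by simp
  note hB = sum_poly_eigenvalues[where r = "\<lambda>b. b \<bullet> f b" and p = p, OF fin(1) this, folded n_def]
  have "\<bar>c \<bullet> g c\<bar> \<le> R" if "c \<in> C" for c
    using g(4)[of c] that C unit[OF that C(1)] span_base[of c C] by simp
  note hC = sum_poly_eigenvalues[where r = "\<lambda>b. b \<bullet> g b" and p = p, OF fin(2) this, folded m_def]
  have le1: "n t \<le> m t + card D" for t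
    using eigenvalue_count_le[OF B(1) lin(1) eB C(1) lin(2) eC _ D(1), of t] B C D(2)
    by (auto simp: n_def m_def of_nat_add[symmetric] simp del: of_nat_add)
  have le2: "m t \<le> n t + card D" for t
    using eigenvalue_count_le[OF C(1) lin(2) eC B(1) lin(1) eB _ D(1), of t] B C D(2)[symmetric]
    by (auto simp: n_def m_def of_nat_add[symmetric] simp del: of_nat_add)
  let ?q = "\<lambda>t. poly (pderiv p) t * indicator {-R..R} t :: real"
  have h: "has_bochner_integral lborel (\<lambda>t. ?q t * m t - ?q t * n t)
      ((\<Sum>e\<in>E. e \<bullet> poly_map p f e) - (\<Sum>e\<in>E. e \<bullet> poly_map p g e))"
    using has_bochner_integral_diff[OF hC hB] by (simp add: trf trg BC)
  have int: "integrable lborel (\<lambda>t. \<bar>poly (pderiv p) t\<bar> * indicator {-R..R} t)"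
    by (rule borel_integrable_atLeastAtMost) (auto intro!: continuous_intros)
  have "\<bar>(\<Sum>e\<in>E. e \<bullet> poly_map p f e) - (\<Sum>e\<in>E. e \<bullet> poly_map p g e)\<bar> =
      norm (\<integral>t. ?q t * m t - ?q t * n t \<partial>lborel)"
    using h by (simp add: has_bochner_integral_iff)
  also have "\<dots> \<le> (\<integral>t. norm (?q t * m t - ?q t * n t) \<partial>lborel)"
    by (rule integral_norm_bound)
  also have "\<dots> \<le> (\<integral>t. card D * (\<bar>poly (pderiv p) t\<bar> * indicator {-R..R} t) \<partial>lborel)"
  proof (rule integral_mono)
    show "integrable lborel (\<lambda>t. norm (?q t * m t - ?q t * n t))"
      using h by (intro integrable_norm) (simp add: has_bochner_integral_iff)
    show "integrable lborel (\<lambda>t. card D * (\<bar>poly (pderiv p) t\<bar> * indicator {-R..R} t))"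
      using int by simp
    fix t
    have "norm (?q t * m t - ?q t * n t) = \<bar>?q t\<bar> * \<bar>m t - n t\<bar>"
      by (simp add: right_diff_distrib[symmetric] abs_mult del: mult.assoc)
    also have "\<dots> \<le> \<bar>?q t\<bar> * card D"
      using le1[of t] le2[of t] by (intro mult_left_mono) auto
    finally show "norm (?q t * m t - ?q t * n t) \<le> card D * (\<bar>poly (pderiv p) t\<bar> * indicator {-R..R} t)"
      by (simp add: abs_mult mult_ac)
  qed
  also have "\<dots> = card D * (\<integral>t. \<bar>poly (pderiv p) t\<bar> * indicator {-R..R} t \<partial>lborel)"
    by simp
  finally show ?thesis .
qed

section \<open>Operators of finite range\<close>

text \<open>\<open>span E\<close> need not be invariant under \<open>A\<close>. Projecting back
  keeps symmetry and the quadratic form on \<open>span E\<close>, so all eigenvalues stay within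
  \<open>norm A\<close>.\<close>

lemma compression:
  fixes A :: "'a::real_inner \<Rightarrow>\<^sub>L 'a"
  assumes E: "orthonormal E" and A: "\<And>x y. x \<bullet> blinfun_apply A y = blinfun_apply A x \<bullet> y"
    and f: "f = (\<lambda>x. projection E (blinfun_apply A x))"
  shows "bounded_linear f"
    and "f x \<in> span E"
    and "x \<in> span E \<Longrightarrow> y \<in> span E \<Longrightarrow> x \<bullet> f y = f x \<bullet> y"
    and "x \<in> span E \<Longrightarrow> x \<bullet> f x = x \<bullet> blinfun_apply A x"
    and "x \<in> span E \<Longrightarrow> norm x = 1 \<Longrightarrow> \<bar>x \<bullet> f x\<bar> \<le> norm A"
proof -
  show "bounded_linear f"
    unfolding f by (rule bounded_linear_compose[OF bounded_linear_projection blinfun.bounded_linear_right])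
  show "f x \<in> span E"
    unfolding f by (rule projection_in_span)
  have inner_f: "x \<bullet> f y = x \<bullet> blinfun_apply A y" if "x \<in> span E" for x y
    unfolding f using E that by (rule inner_projection_span)
  show "x \<bullet> f x = x \<bullet> blinfun_apply A x" if "x \<in> span E"
    using that by (rule inner_f)
  show "x \<bullet> f y = f x \<bullet> y" if "x \<in> span E" "y \<in> span E"
  proof -
    have "f x \<bullet> y = y \<bullet> blinfun_apply A x"
      unfolding inner_commute[of "f x" y] using that(2) by (rule inner_f)
    also have "\<dots> = x \<bullet> blinfun_apply A y"
      unfolding A[of x] by (rule inner_commute)
    finally show ?thesis
      using inner_f[OF that(1)] by simp
  qed
  show "\<bar>x \<bullet> f x\<bar> \<le> norm A" if "x \<in> span E" "norm x = 1"
    using inner_f[OF that(1), of x] Cauchy_Schwarz_ineq2[of x "blinfun_apply A x"]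
      norm_blinfun[of A x] that(2) by simp
qed

text \<open>
  On the Krylov space of \<open>x\<close> the operator \<open>A\<close> and its compression have the same action on \<open>x\<close>
  up to the power \<open>degree q\<close>, and the compression can be diagonalised.
\<close>

lemma norm_poly_map_le:
  fixes A :: "'a::real_inner \<Rightarrow>\<^sub>L 'a"
  assumes A: "\<And>x y. x \<bullet> blinfun_apply A y = blinfun_apply A x \<bullet> y"
    and M: "\<And>t. \<bar>t\<bar> \<le> norm A \<Longrightarrow> \<bar>poly q t\<bar> \<le> M"
  shows "norm (poly_map q (blinfun_apply A) x) \<le> M * norm x"
proof -
  obtain E where E: "orthonormal E" and spE: "span E = span ((\<lambda>k. (blinfun_apply A ^^ k) x) ` {..degree q})"
    using orthonormal_basis_exists[of "(\<lambda>k. (blinfun_apply A ^^ k) x) ` {..degree q}"] by auto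
  define f where "f = (\<lambda>y. projection E (blinfun_apply A y))"
  have inE: "(blinfun_apply A ^^ k) x \<in> span E" if "k \<le> degree q" for k
    using that by (auto simp: spE intro: span_base)
  have "(blinfun_apply A ^^ k) x = (f ^^ k) x" if "k \<le> degree q" for k
    using that
  proof (induction k)
    case (Suc k)
    then show ?case
      using projection_id[OF E inE[OF Suc.prems]] by (simp add: f_def)
  qed simp
  then have eq: "poly_map q (blinfun_apply A) x = poly_map q f x"
    by (rule poly_map_cong)
  note cf = compression[OF E A f_def]
  obtain B where B: "orthonormal B" "span B = span E" and eB: "\<And>b. b \<in> B \<Longrightarrow> f b = (b \<bullet> f b) *\<^sub>R b"
    using symmetric_eigenbasis[OF E cf(1) cf(2) cf(3)] by blast
  have lin: "linear f"
    using cf(1) by (rule bounded_linear.linear)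
  have unit: "norm b = 1" if "b \<in> B" for b
    using that B(1) by (auto simp: orthonormal_def norm_eq_sqrt_inner)
  have M': "\<bar>poly q (b \<bullet> f b)\<bar> \<le> M" if "b \<in> B" for b
    using cf(5)[of b] unit[OF that] that B span_base[of b B] by (intro M) simp
  have M0: "0 \<le> M" using M[of 0] by simp
  have x: "x \<in> span B" using inE[of 0] B by simp
  \<comment> \<open>The polynomial of \<open>f\<close> applied to \<open>x\<close>, in the
    eigenbasis: each coefficient is multiplied by the value of \<open>q\<close> at an eigenvalue,
    which lies in \<open>{- norm A..norm A}\<close>.\<close>
  define y where "y = (\<Sum>b\<in>B. ((b \<bullet> x) * poly q (b \<bullet> f b)) *\<^sub>R b)"
  have "poly_map q f x = poly_map q f (projection B x)"
    by (simp add: projection_id[OF B(1) x])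
  also have "\<dots> = y"
    unfolding projection_def linear_sum[OF linear_poly_map[OF lin]] linear_scale[OF linear_poly_map[OF lin]] y_def
    by (intro sum.cong refl, subst poly_map_eigenvector[OF lin eB]) auto
  finally have fy: "poly_map q f x = y" .
  have yB: "y \<in> span B"
    unfolding y_def by (intro span_sum span_scale span_base)
  have coord_y: "b \<bullet> y = (b \<bullet> x) * poly q (b \<bullet> f b)" if "b \<in> B" for b
  proof -
    have "b \<bullet> y = (\<Sum>c\<in>B. if c = b then (b \<bullet> x) * poly q (b \<bullet> f b) else 0)"
      unfolding y_def inner_sum_right using B(1) that
      by (intro sum.cong refl) (auto simp: orthonormal_def)
    then show ?thesis using that orthonormal_finite[OF B(1)] by simp
  qed
  have "(norm y)\<^sup>2 = (\<Sum>b\<in>B. (b \<bullet> y)\<^sup>2)"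
    by (rule norm_orthonormal_expansion[OF B(1) yB])
  also have "\<dots> \<le> (\<Sum>b\<in>B. M\<^sup>2 * (b \<bullet> x)\<^sup>2)"
  proof (rule sum_mono)
    fix b assume "b \<in> B"
    have "(poly q (b \<bullet> f b))\<^sup>2 \<le> M\<^sup>2"
      using M'[OF \<open>b \<in> B\<close>] M0 by (simp add: abs_le_square_iff[symmetric])
    then have "(poly q (b \<bullet> f b))\<^sup>2 * (b \<bullet> x)\<^sup>2 \<le> M\<^sup>2 * (b \<bullet> x)\<^sup>2"
      by (rule mult_right_mono) simp
    then show "(b \<bullet> y)\<^sup>2 \<le> M\<^sup>2 * (b \<bullet> x)\<^sup>2"
      by (simp add: coord_y[OF \<open>b \<in> B\<close>] power_mult_distrib mult.commute)
  qed
  also have "\<dots> = (M * norm x)\<^sup>2"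
    by (simp add: norm_orthonormal_expansion[OF B(1) x] sum_distrib_left power_mult_distrib)
  finally have "norm y \<le> M * norm x"
    by (rule power2_le_imp_le) (simp add: M0)
  then show ?thesis by (simp add: eq fy)
qed

section \<open>Functional calculus on polynomials\<close>

lemma poly_op_diff: "poly_op (p - q) A = poly_op p A - poly_op q A"
proof -
  define N where "N = max (degree p) (degree q)"
  \<comment> \<open>The defining sums stop at the degree, which may drop in \<open>p - q\<close>;
    vanishing coefficients allow a common upper limit.\<close>
  have ext: "poly_op r A = (\<Sum>k\<le>N. coeff r k *\<^sub>R ((\<lambda>B. A o\<^sub>L B) ^^ k) id_blinfun)" if "degree r \<le> N" for r
    unfolding poly_op_def using that
    by (intro sum.mono_neutral_left) (auto simp: coeff_eq_0)
  have "degree (p - q) \<le> N"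
    unfolding N_def by (rule degree_diff_le_max)
  then show ?thesis
    by (simp add: ext N_def sum_subtractf scaleR_left_diff_distrib)
qed

lemma selfadjoint_inner:
  "selfadjoint A \<Longrightarrow> x \<bullet> blinfun_apply A y = blinfun_apply A x \<bullet> y"
  by (simp add: selfadjoint_def inner_ell2_def)

text \<open>This takes the place of the spectral theorem: polynomials that are uniformly close on
  the interval give operators that are close in norm.\<close>

lemma norm_poly_op_le:
  assumes "selfadjoint A" "\<And>t. \<bar>t\<bar> \<le> norm A \<Longrightarrow> \<bar>poly q t\<bar> \<le> M"
  shows "norm (poly_op q A) \<le> M"
proof (rule norm_blinfun_bound)
  show "0 \<le> M" using assms(2)[of 0] by simp
  show "norm (blinfun_apply (poly_op q A) x) \<le> M * norm x" for x
    unfolding poly_op_apply by (rule norm_poly_map_le[OF selfadjoint_inner[OF assms(1)] assms(2)])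
qed

text \<open>\<open>fun_calc\<close> is a definite description, so existence and uniqueness are both
  due. Existence: any approximating polynomial differs from \<open>p\<close> by a polynomial that is
  small on the interval. Uniqueness: the constant sequence \<open>p\<close> is admissible.\<close>

lemma fun_calc_poly:
  assumes A: "selfadjoint A" and \<phi>: "\<And>t. \<bar>t\<bar> \<le> norm A \<Longrightarrow> \<phi> t = poly p t"
  shows "fun_calc \<phi> A = poly_op p A"
proof -
  have \<phi>': "\<phi> t = poly p t" if "t \<in> {- norm A..norm A}" for t
    using that by (intro \<phi>) auto
  show ?thesis
    unfolding fun_calc_def
  proof (rule the_equality)
    show "\<forall>q. uniform_limit {- norm A..norm A} (\<lambda>n. poly (q n)) \<phi> sequentially \<longrightarrow>
        (\<lambda>n. poly_op (q n) A) \<longlonglongrightarrow> poly_op p A"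
    proof (intro allI impI)
      fix q assume lim: "uniform_limit {- norm A..norm A} (\<lambda>n. poly (q n)) \<phi> sequentially"
      show "(\<lambda>n. poly_op (q n) A) \<longlonglongrightarrow> poly_op p A"
      proof (rule tendstoI)
        fix e :: real assume "0 < e"
        then have "\<forall>\<^sub>F n in sequentially. \<forall>t\<in>{- norm A..norm A}. dist (poly (q n) t) (\<phi> t) < e / 2"
          by (intro uniform_limitD[OF lim]) simp
        then show "\<forall>\<^sub>F n in sequentially. dist (poly_op (q n) A) (poly_op p A) < e"
        proof eventually_elim
          case (elim n)
          have "norm (poly_op (q n - p) A) \<le> e / 2"
          proof (rule norm_poly_op_le[OF A])
            fix t :: real assume t: "\<bar>t\<bar> \<le> norm A"
            then have "t \<in> {- norm A..norm A}" by auto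
            with elim have "dist (poly (q n) t) (\<phi> t) < e / 2" by blast
            then show "\<bar>poly (q n - p) t\<bar> \<le> e / 2"
              by (simp add: dist_real_def \<phi>[OF t])
          qed
          then show ?case using \<open>0 < e\<close> by (simp add: dist_norm poly_op_diff)
        qed
      qed
    qed
    fix B assume "\<forall>q. uniform_limit {- norm A..norm A} (\<lambda>n. poly (q n)) \<phi> sequentially \<longrightarrow>
        (\<lambda>n. poly_op (q n) A) \<longlonglongrightarrow> B"
    from this[rule_format, of "\<lambda>_. p"] have "(\<lambda>n. poly_op p A) \<longlonglongrightarrow> B"
      using \<phi>' by (simp add: uniform_limit_iff)
    then show "B = poly_op p A"
      by (simp add: LIMSEQ_const_iff)
  qed
qed

section \<open>Site vectors and finite propagation\<close>

lemma cinner_ket: "cinner (ket a) x = coord x a"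
proof -
  have "cinner (ket a) x = (\<Sum>\<^sub>\<infinity>b\<in>{a}. coord x b)"
    unfolding cinner_def by (rule infsum_cong_neutral) (auto simp: coord_ket)
  then show ?thesis by simp
qed

lemma inner_ket: "ket a \<bullet> x = Re (coord x a)"
  by (simp add: inner_ell2_def cinner_ket)

lemma inj_ket: "inj ket"
proof (rule injI)
  fix a b :: 'a assume "ket a = ket b"
  then have "coord (ket a) a = coord (ket b) a" by simp
  then show "a = b" by (simp add: coord_ket split: if_splits)
qed

lemma orthonormal_ket: "finite F \<Longrightarrow> orthonormal (ket ` F)"
  by (auto simp: orthonormal_def inner_ket coord_ket inj_eq[OF inj_ket])

lemma linear_image_span_subset:
  assumes "linear f" "\<And>y. y \<in> Y \<Longrightarrow> f y \<in> span Z" "x \<in> span Y"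
  shows "f x \<in> span Z"
proof -
  have "f x \<in> span (f ` Y)"
    unfolding linear_span_image[OF assms(1)] using assms(3) by (rule imageI)
  also have "\<dots> \<subseteq> span Z"
    by (rule span_minimal) (use assms(2) in auto)
  finally show ?thesis .
qed

lemma projection_ket:
  assumes "finite F"
  shows "projection (ket ` F) (ket a) = (if a \<in> F then ket a else 0)"
proof -
  have "projection (ket ` F) (ket a) = (\<Sum>b\<in>F. if b = a then ket a else 0)"
    unfolding projection_def sum.reindex[OF inj_on_subset[OF inj_ket subset_UNIV]]
    by (intro sum.cong) (auto simp: inner_ket coord_ket)
  then show ?thesis using assms by simp
qed

text \<open>Projecting to finitely many sites does not enlarge the support, so a compression
  inherits the range of the operator.\<close>

lemma projection_span_ket:
  assumes "finite F" "x \<in> span (ket ` Y)"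
  shows "projection (ket ` F) x \<in> span (ket ` Y)"
proof (rule linear_image_span_subset[OF _ _ assms(2)])
  show "linear (projection (ket ` F))"
    by (rule bounded_linear.linear[OF bounded_linear_projection])
  show "projection (ket ` F) y \<in> span (ket ` Y)" if "y \<in> ket ` Y" for y
    using that span_base[OF that] by (auto simp: projection_ket[OF assms(1)] span_zero)
qed

text \<open>Finite propagation: each application of \<open>f\<close> moves the support by one step
  of \<open>r\<close>.\<close>

lemma funpow_ket_in_span:
  fixes f :: "'a ell2 \<Rightarrow> 'a ell2" and r :: "'a rel"
  assumes "\<And>Y x. x \<in> span (ket ` Y) \<Longrightarrow> f x \<in> span (ket ` (r `` Y))"
  shows "(f ^^ k) (ket a) \<in> span (ket ` ((r ^^ k) `` {a}))"
proof (induction k)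
  case 0
  show ?case by (auto intro: span_base)
next
  case (Suc k)
  from assms[OF this] show ?case by (simp add: relcomp_Image)
qed

lemma relpow_mono_refl:
  fixes r :: "'a rel"
  assumes "\<And>a. (a, a) \<in> r" "k \<le> d"
  shows "r ^^ k \<subseteq> r ^^ d"
  using assms(2)
proof (induction d rule: dec_induct)
  case (step d)
  then show ?case using assms(1) by (auto intro: relpow_Suc_I)
qed simp

lemma sym_relpow:
  fixes r :: "'a rel"
  assumes "sym r"
  shows "sym (r ^^ k)"
proof (induction k)
  case (Suc k)
  show ?case
  proof (rule symI)
    fix a b assume "(a, b) \<in> r ^^ Suc k"
    then obtain c where "(a, c) \<in> r ^^ k" "(c, b) \<in> r" by auto
    then show "(b, a) \<in> r ^^ Suc k"
      using Suc assms by (intro relpow_Suc_I2[of _ c]) (auto dest: symD)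
  qed
qed (simp add: sym_Id)

lemma finite_relpow_Image:
  fixes r :: "'a rel"
  assumes "\<And>a. finite (r `` {a})" "finite Y"
  shows "finite ((r ^^ k) `` Y)"
proof (induction k)
  case (Suc k)
  have "(r ^^ Suc k) `` Y = (\<Union>a\<in>(r ^^ k) `` Y. r `` {a})"
    by auto
  then show ?case using Suc assms(1) by simp
qed (simp add: assms(2))

text \<open>Started at \<open>a\<close>, the support does not meet \<open>S\<close> within
  \<open>d\<close> steps, and away from \<open>S\<close> the two maps coincide.\<close>

lemma funpow_ket_eq:
  fixes f g :: "'a ell2 \<Rightarrow> 'a ell2" and r :: "'a rel"
  assumes f: "\<And>Y x. x \<in> span (ket ` Y) \<Longrightarrow> f x \<in> span (ket ` (r `` Y))"
    and fg: "\<And>Y x. x \<in> span (ket ` Y) \<Longrightarrow> Y \<inter> S = {} \<Longrightarrow> g x = f x"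
    and r: "\<And>a. (a, a) \<in> r" and disj: "(r ^^ d) `` {a} \<inter> S = {}" and k: "k \<le> d"
  shows "(g ^^ k) (ket a) = (f ^^ k) (ket a)"
  using k
proof (induction k)
  case (Suc k)
  have "r ^^ k \<subseteq> r ^^ d" using relpow_mono_refl[OF r] Suc.prems by simp
  then have "(r ^^ k) `` {a} \<inter> S = {}" using disj by blast
  from fg[OF funpow_ket_in_span[OF f] this] Suc show ?case by simp
qed simp

text \<open>Since \<open>span\<close> is the real span, \<open>Ar\<close> and \<open>C1\<close>
  express both short range and reality of the matrix entries; the problem becomes one about real
  symmetric matrices. \<open>C\<close> is diagonal and lives on \<open>S\<close>, so the quadratic
  forms agree on vectors orthogonal to the site vectors of \<open>S\<close>, and
  \<open>card S\<close> bounds the shift of the eigenvalue count.\<close>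

theorem op_trace_poly_bound:
  fixes A C :: "'a ell2 \<Rightarrow>\<^sub>L 'a ell2" and r :: "'a rel"
  assumes A: "selfadjoint A" and AC: "selfadjoint (A + C)"
    and r: "\<And>a. (a, a) \<in> r" "sym r" "\<And>a. finite (r `` {a})"
    and Ar: "\<And>a. blinfun_apply A (ket a) \<in> span (ket ` (r `` {a}))"
    and S: "finite S" and C0: "\<And>a. a \<notin> S \<Longrightarrow> blinfun_apply C (ket a) = 0"
    and C1: "\<And>a. blinfun_apply C (ket a) \<in> span {ket a}"
    and R: "norm A \<le> R" "norm (A + C) \<le> R"
  shows "\<bar>Re (op_trace (poly_op p (A + C) - poly_op p A))\<bar>
    \<le> real (card S) * (\<integral>t. \<bar>poly (pderiv p) t\<bar> * indicator {-R..R} t \<partial>lborel)"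
proof -
  define d where "d = degree p"
  \<comment> \<open>Sites from which \<open>S\<close> can be reached in \<open>degree p\<close>
    steps. Elsewhere the two polynomials act alike on the site vector and contribute nothing to the
    trace.\<close>
  define X where "X = {a. (r ^^ d) `` {a} \<inter> S \<noteq> {}}"
  \<comment> \<open>By symmetry the sites that reach \<open>S\<close> are reached from
    \<open>S\<close>, which makes \<open>X\<close> finite.\<close>
  have "sym (r ^^ k)" for k
    by (rule sym_relpow[OF r(2)])
  then have "X \<subseteq> (r ^^ d) `` S"
    unfolding X_def sym_def by blast
  then have finX: "finite X"
    using finite_relpow_Image[of r S d] r(3) S finite_subset by blast
  \<comment> \<open>A second margin of \<open>d\<close> steps: powers up to \<open>d\<close> started
    in \<open>X\<close> stay in the span of the sites of \<open>F\<close>, so compression does not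
    change them.\<close>
  define F where "F = X \<union> (r ^^ d) `` X"
  have finF: "finite F"
    using finX finite_relpow_Image[of r X d] r(3) by (simp add: F_def)
  define E where "E = (ket ` F :: 'a ell2 set)"
  have E: "orthonormal E"
    unfolding E_def by (rule orthonormal_ket[OF finF])
  have Asp: "blinfun_apply A x \<in> span (ket ` (r `` Y))" if "x \<in> span (ket ` Y)" for x Y
  proof (rule linear_image_span_subset[OF bounded_linear.linear[OF blinfun.bounded_linear_right] _ that])
    fix y assume "y \<in> ket ` Y"
    then obtain a where a: "a \<in> Y" "y = ket a" by blast
    have "ket ` (r `` {a}) \<subseteq> ket ` (r `` Y)" using a(1) by blast
    from span_mono[OF this] show "blinfun_apply A y \<in> span (ket ` (r `` Y))"
      using Ar[of a] a(2) by blast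
  qed
  have Csp: "blinfun_apply C x \<in> span (ket ` (r `` Y))" if "x \<in> span (ket ` Y)" for x Y
  proof (rule linear_image_span_subset[OF bounded_linear.linear[OF blinfun.bounded_linear_right] _ that])
    fix y assume "y \<in> ket ` Y"
    then obtain a where a: "a \<in> Y" "y = ket a" by blast
    have "{ket a} \<subseteq> ket ` (r `` Y)" using a(1) r(1) by blast
    from span_mono[OF this] show "blinfun_apply C y \<in> span (ket ` (r `` Y))"
      using C1[of a] a(2) by blast
  qed
  have ACsp: "blinfun_apply (A + C) x \<in> span (ket ` (r `` Y))" if "x \<in> span (ket ` Y)" for x Y
    using Asp[OF that] Csp[OF that] by (simp add: blinfun.add_left span_add)
  have Cz: "blinfun_apply C x = 0" if "x \<in> span (ket ` Y)" "Y \<inter> S = {}" for x Y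
  proof -
    have "blinfun_apply C x \<in> span {}"
      by (rule linear_image_span_subset[OF bounded_linear.linear[OF blinfun.bounded_linear_right] _ that(1)]) (use C0 that(2) in auto)
    then show ?thesis by simp
  qed
  have ACeq: "blinfun_apply (A + C) x = blinfun_apply A x" if "x \<in> span (ket ` Y)" "Y \<inter> S = {}" for x Y
    using Cz[OF that] by (simp add: blinfun.add_left)
  define f where "f = (\<lambda>x. projection E (blinfun_apply (A + C) x))"
  define g where "g = (\<lambda>x. projection E (blinfun_apply A x))"
  note cf = compression[OF E selfadjoint_inner[OF AC] f_def]
  note cg = compression[OF E selfadjoint_inner[OF A] g_def]
  have gsp: "g x \<in> span (ket ` (r `` Y))" if "x \<in> span (ket ` Y)" for x Y
    unfolding g_def E_def by (rule projection_span_ket[OF finF Asp[OF that]])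
  have fg: "f x = g x" if "x \<in> span (ket ` Y)" "Y \<inter> S = {}" for x Y
    using ACeq[OF that] by (simp add: f_def g_def)
  have far: "poly_map p f (ket a) = poly_map p g (ket a)"
    "poly_map p (blinfun_apply (A + C)) (ket a) = poly_map p (blinfun_apply A) (ket a)" if "a \<notin> X" for a
  proof -
    have disj: "(r ^^ d) `` {a} \<inter> S = {}" using that by (simp add: X_def)
    show "poly_map p f (ket a) = poly_map p g (ket a)"
      by (rule poly_map_cong) (use funpow_ket_eq[OF gsp fg r(1) disj] in \<open>simp add: d_def\<close>)
    show "poly_map p (blinfun_apply (A + C)) (ket a) = poly_map p (blinfun_apply A) (ket a)"
      by (rule poly_map_cong) (use funpow_ket_eq[OF Asp ACeq r(1) disj] in \<open>simp add: d_def\<close>)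
  qed
  have near: "poly_map p (\<lambda>x. projection E (blinfun_apply G x)) (ket a) = poly_map p (blinfun_apply G) (ket a)"
    if a: "a \<in> X" and G: "\<And>x Y. x \<in> span (ket ` Y) \<Longrightarrow> blinfun_apply G x \<in> span (ket ` (r `` Y))" for a G
  proof (rule poly_map_cong)
    fix k assume "k \<le> degree p"
    then show "((\<lambda>x. projection E (blinfun_apply G x)) ^^ k) (ket a) = (blinfun_apply G ^^ k) (ket a)"
    proof (induction k)
      case (Suc k)
      have "r ^^ Suc k \<subseteq> r ^^ d"
        using Suc.prems by (intro relpow_mono_refl r) (simp add: d_def)
      then have "ket ` ((r ^^ Suc k) `` {a}) \<subseteq> E"
        using a unfolding E_def F_def by blast
      then have "(blinfun_apply G ^^ Suc k) (ket a) \<in> span E"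
        using funpow_ket_in_span[of "blinfun_apply G" r "Suc k" a, OF G] span_mono by blast
      then have "projection E ((blinfun_apply G ^^ Suc k) (ket a)) = (blinfun_apply G ^^ Suc k) (ket a)"
        by (rule projection_id[OF E])
      then show ?case using Suc by simp
    qed simp
  qed
  let ?T = "poly_op p (A + C) - poly_op p A"
  have T: "blinfun_apply ?T x = poly_map p (blinfun_apply (A + C)) x - poly_map p (blinfun_apply A) x" for x
    by (simp add: blinfun.diff_left poly_op_apply)
  have "op_trace ?T = (\<Sum>\<^sub>\<infinity>a\<in>X. cinner (ket a) (blinfun_apply ?T (ket a)))"
    unfolding op_trace_def
    by (rule infsum_cong_neutral) (auto simp: T far(2) cinner_ket)
  then have "Re (op_trace ?T) = (\<Sum>a\<in>X. ket a \<bullet> blinfun_apply ?T (ket a))"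
    using finX by (simp add: inner_ell2_def)
  also have "\<dots> = (\<Sum>a\<in>X. ket a \<bullet> poly_map p f (ket a) - ket a \<bullet> poly_map p g (ket a))"
    unfolding f_def g_def
    by (intro sum.cong refl) (simp add: near[OF _ ACsp] near[OF _ Asp] T inner_diff_right)
  \<comment> \<open>At sites of \<open>F\<close> outside \<open>X\<close> the compressions also have
    equal polynomials, so the sum extends to a full trace over \<open>E\<close>.\<close>
  also have "\<dots> = (\<Sum>a\<in>F. ket a \<bullet> poly_map p f (ket a) - ket a \<bullet> poly_map p g (ket a))"
    using finF by (intro sum.mono_neutral_left) (auto simp: F_def far(1))
  also have "\<dots> = (\<Sum>e\<in>E. e \<bullet> poly_map p f e) - (\<Sum>e\<in>E. e \<bullet> poly_map p g e)"
    unfolding E_def sum.reindex[OF inj_on_subset[OF inj_ket subset_UNIV]]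
    by (simp add: sum_subtractf)
  finally have "\<bar>Re (op_trace ?T)\<bar> = \<bar>(\<Sum>e\<in>E. e \<bullet> poly_map p f e) - (\<Sum>e\<in>E. e \<bullet> poly_map p g e)\<bar>"
    by simp
  also have "\<dots> \<le> real (card (ket ` S :: 'a ell2 set)) *
      (\<integral>t. \<bar>poly (pderiv p) t\<bar> * indicator {-R..R} t \<partial>lborel)"
  proof (rule trace_difference_bound[OF E cf(1) cf(2) cf(3) _ cg(1) cg(2) cg(3)])
    show "\<bar>x \<bullet> f x\<bar> \<le> R" if "x \<in> span E" "norm x = 1" for x
      using cf(5)[OF that] R by simp
    show "\<bar>x \<bullet> g x\<bar> \<le> R" if "x \<in> span E" "norm x = 1" for x
      using cg(5)[OF that] R by simp
    show "finite (ket ` S)" using S by simp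
    show "x \<bullet> f x = x \<bullet> g x" if x: "x \<in> span E" and orth: "\<And>d. d \<in> ket ` S \<Longrightarrow> d \<bullet> x = 0" for x
    proof -
      have "blinfun_apply C x = blinfun_apply C (projection E x)"
        by (simp add: projection_id[OF E x])
      also have "\<dots> = (\<Sum>e\<in>E. (e \<bullet> x) *\<^sub>R blinfun_apply C e)"
        by (simp add: projection_def blinfun.sum_right blinfun.scaleR_right)
      also have "\<dots> = 0"
        using orth C0 by (intro sum.neutral) (auto simp: E_def)
      finally show ?thesis
        using cf(4)[OF x] cg(4)[OF x] by (simp add: blinfun.add_left)
    qed
  qed
  also have "card (ket ` S :: 'a ell2 set) = card S"
    by (rule card_image) (rule inj_on_subset[OF inj_ket subset_UNIV])
  finally show ?thesis .
qed

section \<open>Smooth cutoff functions\<close>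

text \<open>Counting orders makes the closure rules inductive: the derivative of a product or
  inverse involves the functions and their derivatives one order lower.
  \<open>smooth_upto_iff\<close> leads back to the iterated \<open>deriv\<close> of
  \<open>C0_infinity\<close>.\<close>

primrec smooth_upto :: "nat \<Rightarrow> (real \<Rightarrow> real) \<Rightarrow> bool" where
  "smooth_upto 0 f = True"
| "smooth_upto (Suc n) f = ((\<forall>x. f field_differentiable at x) \<and> smooth_upto n (deriv f))"

lemma smooth_upto_iff:
  "smooth_upto n f \<longleftrightarrow> (\<forall>k<n. \<forall>x. (deriv ^^ k) f field_differentiable at x)"
proof (induction n arbitrary: f)
  case (Suc n)
  show ?case
    unfolding smooth_upto.simps Suc All_less_Suc2 by (simp add: funpow_swap1)
qed simp

lemma smooth_upto_SucI:
  assumes "\<And>x. (f has_real_derivative f' x) (at x)" "smooth_upto n f'"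
  shows "smooth_upto (Suc n) f"
proof -
  have "deriv f = f'"
    using assms(1) by (intro ext DERIV_imp_deriv)
  then show ?thesis
    using assms by (auto simp: field_differentiable_def)
qed

lemma smooth_upto_deriv:
  "smooth_upto (Suc n) f \<Longrightarrow> (f has_real_derivative deriv f x) (at x)"
  using field_differentiable_derivI[of f x] by simp

lemma smooth_upto_mono: "smooth_upto (Suc n) f \<Longrightarrow> smooth_upto n f"
  by (induction n arbitrary: f) auto

lemma smooth_upto_const: "smooth_upto n (\<lambda>_. c)"
proof (induction n arbitrary: c)
  case (Suc n)
  show ?case by (rule smooth_upto_SucI[OF DERIV_const Suc])
qed simp

lemma smooth_upto_poly: "smooth_upto n (poly p)"
proof (induction n arbitrary: p)
  case (Suc n)
  show ?case by (rule smooth_upto_SucI[OF poly_DERIV Suc])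
qed simp

lemma smooth_upto_add:
  "smooth_upto n f \<Longrightarrow> smooth_upto n g \<Longrightarrow> smooth_upto n (\<lambda>x. f x + g x)"
proof (induction n arbitrary: f g)
  case (Suc n)
  have "smooth_upto n (\<lambda>x. deriv f x + deriv g x)"
    using Suc by simp
  then show ?case
    by (rule smooth_upto_SucI[rotated]) (rule DERIV_add[OF smooth_upto_deriv[OF Suc.prems(1)] smooth_upto_deriv[OF Suc.prems(2)]])
qed simp

lemma smooth_upto_mult:
  "smooth_upto n f \<Longrightarrow> smooth_upto n g \<Longrightarrow> smooth_upto n (\<lambda>x. f x * g x)"
proof (induction n arbitrary: f g)
  case (Suc n)
  have "smooth_upto n (\<lambda>x. deriv f x * g x + deriv g x * f x)"
    using Suc.prems smooth_upto_mono[OF Suc.prems(1)] smooth_upto_mono[OF Suc.prems(2)]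
    by (intro smooth_upto_add Suc.IH) simp_all
  then show ?case
    by (rule smooth_upto_SucI[rotated]) (rule DERIV_mult[OF smooth_upto_deriv[OF Suc.prems(1)] smooth_upto_deriv[OF Suc.prems(2)]])
qed simp

lemma smooth_upto_inverse:
  assumes "smooth_upto n f" "\<And>x. f x \<noteq> 0"
  shows "smooth_upto n (\<lambda>x. inverse (f x))"
  using assms(1)
proof (induction n)
  case (Suc n)
  have inv: "smooth_upto n (\<lambda>x. inverse (f x))"
    by (rule Suc.IH[OF smooth_upto_mono[OF Suc.prems]])
  have "smooth_upto n (\<lambda>x. (-1) * (inverse (f x) * deriv f x * inverse (f x)))"
    using Suc.prems by (intro smooth_upto_mult smooth_upto_const inv) simp
  moreover have "((\<lambda>x. inverse (f x)) has_real_derivative (-1) * (inverse (f x) * deriv f x * inverse (f x))) (at x)" for x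
    using DERIV_inverse'[OF smooth_upto_deriv[OF Suc.prems] assms(2)] by simp
  ultimately show ?case
    by (rule smooth_upto_SucI[rotated])
qed simp

lemma smooth_upto_affine:
  "smooth_upto n f \<Longrightarrow> smooth_upto n (\<lambda>x. f (c * x + d))"
proof (induction n arbitrary: f)
  case (Suc n)
  have "smooth_upto n (\<lambda>x. deriv f (c * x + d) * c)"
    using Suc by (intro smooth_upto_mult smooth_upto_const) simp
  moreover have "((\<lambda>x. f (c * x + d)) has_real_derivative deriv f (c * x + d) * c) (at x)" for x
    by (rule DERIV_chain2[OF smooth_upto_deriv[OF Suc.prems]]) (auto intro!: derivative_eq_intros)
  ultimately show ?case
    by (rule smooth_upto_SucI[rotated])
qed simp

section \<open>A smooth step built from \<open>exp (- (1 / t))\<close>\<close>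

definition flat :: "real poly \<Rightarrow> real \<Rightarrow> real"
  where "flat q t = (if t > 0 then poly q (1 / t) * exp (- (1 / t)) else 0)"

lemma poly_times_exp_tendsto_0:
  fixes q :: "real poly"
  shows "((\<lambda>u. poly q u * exp (- u)) \<longlongrightarrow> 0) at_top"
proof -
  have "((\<lambda>u. \<Sum>k\<le>degree q. coeff q k * (u ^ k / exp u)) \<longlongrightarrow> (\<Sum>k\<le>degree q. coeff q k * 0)) at_top"
    by (intro tendsto_sum tendsto_mult tendsto_const tendsto_power_div_exp_0)
  then show ?thesis
    by (simp add: poly_altdef sum_distrib_right exp_minus divide_inverse mult.assoc)
qed

text \<open>The family \<open>flat\<close> is closed under differentiation, which yields smoothness
  of every order at once. With \<open>u = 1 / t\<close> the derivative of \<open>u\<close> is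
  \<open>- u\<^sup>2\<close>, whence the factor \<open>[:0, 0, 1:]\<close> and the difference
  \<open>q - pderiv q\<close>.\<close>

lemma flat_has_derivative:
  "(flat q has_real_derivative flat ([:0, 0, 1:] * (q - pderiv q)) t) (at t)"
proof (cases t "0 :: real" rule: linorder_cases)
  case less
  have "((\<lambda>_. 0) has_real_derivative 0) (at t)" by simp
  then have "(flat q has_real_derivative 0) (at t)"
    by (rule has_field_derivative_transform_within_open[of _ _ _ "{..<0}"])
       (use less in \<open>auto simp: flat_def\<close>)
  then show ?thesis using less by (simp add: flat_def)
next
  case greater
  have "((\<lambda>t. poly q (1 / t) * exp (- (1 / t))) has_real_derivative
      flat ([:0, 0, 1:] * (q - pderiv q)) t) (at t)"
    using greater
    by (auto intro!: derivative_eq_intros DERIV_chain2[OF poly_DERIV]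
      simp: flat_def field_simps power2_eq_square)
  then show ?thesis
    by (rule has_field_derivative_transform_within_open[of _ _ _ "{0<..}"])
       (use greater in \<open>auto simp: flat_def\<close>)
next
  case equal
  have "((\<lambda>h. (flat q h - flat q 0) / (h - 0)) \<longlongrightarrow> 0) (at 0)"
  proof (rule filterlim_split_at)
    show "((\<lambda>h. (flat q h - flat q 0) / (h - 0)) \<longlongrightarrow> 0) (at_left 0)"
      by (rule tendsto_eventually) (auto simp: flat_def eventually_at_filter)
    \<comment> \<open>Division by \<open>h\<close> multiplies \<open>q\<close> by its variable
      \<open>1 / h\<close>, hence \<open>pCons 0 q\<close>.\<close>
    have "((\<lambda>h. poly (pCons 0 q) (inverse h) * exp (- inverse h)) \<longlongrightarrow> 0) (at_right (0::real))"
      by (rule filterlim_compose[OF poly_times_exp_tendsto_0 filterlim_inverse_at_top_right])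
    then show "((\<lambda>h. (flat q h - flat q 0) / (h - 0)) \<longlongrightarrow> 0) (at_right 0)"
      by (rule Lim_transform_eventually)
         (auto simp: eventually_at_filter flat_def divide_simps)
  qed
  then show ?thesis
    using equal by (simp add: has_field_derivative_iff flat_def)
qed

lemma smooth_upto_flat: "smooth_upto n (flat q)"
proof (induction n arbitrary: q)
  case (Suc n)
  show ?case by (rule smooth_upto_SucI[OF flat_has_derivative Suc])
qed simp

definition smooth_step :: "real \<Rightarrow> real"
  where "smooth_step t = flat 1 t * inverse (flat 1 t + flat 1 (1 - t))"

text \<open>The denominator of \<open>smooth_step\<close> is positive because \<open>t\<close> and
  \<open>1 - t\<close> are never both nonpositive.\<close>

lemma flat_1: "0 \<le> flat 1 t" "0 < flat 1 t + flat 1 (1 - t)"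
  by (auto simp: flat_def add_pos_pos)

lemma smooth_step_le: "t \<le> 0 \<Longrightarrow> smooth_step t = 0"
  by (simp add: smooth_step_def flat_def)

lemma smooth_step_ge: "1 \<le> t \<Longrightarrow> smooth_step t = 1"
  by (simp add: smooth_step_def flat_def)

lemma smooth_step_bounds: "0 \<le> smooth_step t" "smooth_step t \<le> 1"
  using flat_1[of t] flat_1(1)[of "1 - t"] by (simp_all add: smooth_step_def field_simps)

lemma smooth_upto_smooth_step: "smooth_upto n smooth_step"
proof -
  have "smooth_upto n (\<lambda>t. flat 1 (1 - t))"
    using smooth_upto_affine[OF smooth_upto_flat, of n 1 "-1" 1] by simp
  then show ?thesis
    unfolding smooth_step_def[abs_def] using flat_1(2)
    by (intro smooth_upto_mult smooth_upto_inverse smooth_upto_add smooth_upto_flat)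
       (auto simp: less_le)
qed

text \<open>The derivative is continuous on \<open>{0..1}\<close> and vanishes outside, where the
  step is locally constant.\<close>

lemma deriv_smooth_step_bounded: "\<exists>K. \<forall>t. \<bar>deriv smooth_step t\<bar> \<le> K"
proof -
  have "smooth_upto (Suc 0) (deriv smooth_step)"
    using smooth_upto_smooth_step[of "Suc (Suc 0)"] by simp
  then have "continuous_on {0..1} (deriv smooth_step)"
    by (intro continuous_at_imp_continuous_on ballI field_differentiable_imp_continuous_at) simp
  then have "compact (deriv smooth_step ` {0..1})"
    by (rule compact_continuous_image) simp
  then obtain K where K: "\<And>t. t \<in> {0..1} \<Longrightarrow> \<bar>deriv smooth_step t\<bar> \<le> K"
    by (force dest!: compact_imp_bounded simp: bounded_iff)
  have "\<bar>deriv smooth_step t\<bar> \<le> K" for t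
  proof (cases "t \<in> {0..1}")
    case False
    have "deriv smooth_step t = 0"
    proof (cases "t < 0")
      case True
      have "((\<lambda>_. 0) has_real_derivative 0) (at t)" by simp
      then have "(smooth_step has_real_derivative 0) (at t)"
        by (rule has_field_derivative_transform_within_open[of _ _ _ "{..<0}"])
           (use True in \<open>auto simp: smooth_step_le\<close>)
      then show ?thesis by (rule DERIV_imp_deriv)
    next
      case f: False
      have "((\<lambda>_. 1) has_real_derivative 0) (at t)" by simp
      then have "(smooth_step has_real_derivative 0) (at t)"
        by (rule has_field_derivative_transform_within_open[of _ _ _ "{1<..}"])
           (use f False in \<open>auto simp: smooth_step_ge\<close>)
      then show ?thesis by (rule DERIV_imp_deriv)
    qed
    then show ?thesis using K[of 0] by simp
  qed (rule K)
  then show ?thesis by blast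
qed

text \<open>The coefficients \<open>1\<close> and \<open>- 1\<close> are spelled out to match the
  form \<open>c * x + d\<close> of \<open>smooth_upto_affine\<close>.\<close>

definition cutoff :: "real \<Rightarrow> real \<Rightarrow> real"
  where "cutoff R t = smooth_step (1 * t + (R + 1)) * smooth_step (- 1 * t + (R + 1))"

lemma cutoff_eq_1: "\<bar>t\<bar> \<le> R \<Longrightarrow> cutoff R t = 1"
  by (simp add: cutoff_def smooth_step_ge)

lemma cutoff_eq_0: "R + 1 \<le> \<bar>t\<bar> \<Longrightarrow> cutoff R t = 0"
  by (auto simp: cutoff_def smooth_step_le abs_if split: if_splits)

lemma cutoff_bounds: "0 \<le> cutoff R t" "cutoff R t \<le> 1"
  unfolding cutoff_def by (auto intro!: mult_nonneg_nonneg mult_le_one smooth_step_bounds)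

lemma smooth_upto_cutoff: "smooth_upto n (cutoff R)"
  unfolding cutoff_def[abs_def]
  by (intro smooth_upto_mult smooth_upto_affine smooth_upto_smooth_step)

lemma cutoff_deriv: "(cutoff R has_real_derivative deriv (cutoff R) t) (at t)"
  by (rule smooth_upto_deriv[OF smooth_upto_cutoff[of "Suc 0"]])

lemma deriv_cutoff_eq_0:
  assumes "\<bar>t\<bar> < R \<or> R + 1 < \<bar>t\<bar>"
  shows "deriv (cutoff R) t = 0"
proof -
  have "(cutoff R has_real_derivative 0) (at t)"
  proof (cases "\<bar>t\<bar> < R")
    case True
    have "((\<lambda>_. 1) has_real_derivative 0) (at t)" by simp
    then show ?thesis
      by (rule has_field_derivative_transform_within_open[of _ _ _ "{- R<..<R}"])
         (use True in \<open>auto simp: cutoff_eq_1\<close>)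
  next
    case False
    have "((\<lambda>_. 0) has_real_derivative 0) (at t)" by simp
    then show ?thesis
      by (rule has_field_derivative_transform_within_open[of _ _ _ "{..<- R - 1} \<union> {R + 1<..}"])
         (use False assms in \<open>auto simp: cutoff_eq_0\<close>)
  qed
  then show ?thesis by (rule DERIV_imp_deriv)
qed

text \<open>\<open>R\<close> only translates the two steps, whose transition zones keep length 1.
  Uniformity in \<open>R\<close> matters because \<open>R\<close> is later chosen in terms of
  \<open>K\<close>.\<close>

lemma deriv_cutoff_bounded: "\<exists>K. \<forall>R t. \<bar>deriv (cutoff R) t\<bar> \<le> K"
proof -
  obtain K where K: "\<And>t. \<bar>deriv smooth_step t\<bar> \<le> K"
    using deriv_smooth_step_bounded by blast
  have "\<bar>deriv (cutoff R) t\<bar> \<le> 2 * K" for R t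
  proof -
    let ?a = "1 * t + (R + 1)" and ?b = "- 1 * t + (R + 1)"
    have ss: "(smooth_step has_real_derivative deriv smooth_step x) (at x)" for x
      by (rule smooth_upto_deriv[OF smooth_upto_smooth_step[of "Suc 0"]])
    have "((\<lambda>t. smooth_step (1 * t + (R + 1)) * smooth_step (- 1 * t + (R + 1))) has_real_derivative
        (deriv smooth_step ?a * 1) * smooth_step ?b + (deriv smooth_step ?b * (- 1)) * smooth_step ?a) (at t)"
      by (intro DERIV_mult DERIV_chain2[OF ss]) (auto intro!: derivative_eq_intros)
    from DERIV_imp_deriv[OF this]
    have "deriv (cutoff R) t = deriv smooth_step ?a * smooth_step ?b - deriv smooth_step ?b * smooth_step ?a"
      by (simp add: cutoff_def[abs_def])
    then have "\<bar>deriv (cutoff R) t\<bar> \<le> \<bar>deriv smooth_step ?a * smooth_step ?b\<bar> + \<bar>deriv smooth_step ?b * smooth_step ?a\<bar>"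
      by (simp only: abs_triangle_ineq4)
    also have "\<dots> \<le> K * 1 + K * 1"
      unfolding abs_mult using smooth_step_bounds K[of 0]
      by (intro add_mono mult_mono K) (auto intro: order_trans[OF abs_ge_zero K])
    finally show ?thesis by simp
  qed
  then show ?thesis by blast
qed

lemma poly_cutoff_C0_infinity: "(\<lambda>t. poly p t * cutoff R t) \<in> C0_infinity"
proof -
  have "smooth_upto (Suc k) (\<lambda>t. poly p t * cutoff R t)" for k
    by (intro smooth_upto_mult smooth_upto_poly smooth_upto_cutoff)
  then have "(deriv ^^ k) (\<lambda>t. poly p t * cutoff R t) field_differentiable at x" for k x
    unfolding smooth_upto_iff by blast
  moreover have "{t. poly p t * cutoff R t \<noteq> 0} \<subseteq> {- (R + 1)..R + 1}"
  proof
    fix t assume "t \<in> {t. poly p t * cutoff R t \<noteq> 0}"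
    then have "\<not> R + 1 \<le> \<bar>t\<bar>" using cutoff_eq_0[of R t] by auto
    then show "t \<in> {- (R + 1)..R + 1}" by (auto simp: abs_le_iff)
  qed
  then have "bounded {t. poly p t * cutoff R t \<noteq> 0}"
    by (rule bounded_subset[rotated]) simp
  ultimately show ?thesis
    by (simp add: C0_infinity_def)
qed

text \<open>Weierstrass approximation of \<open>g\<close>, followed by a termwise antiderivative
  \<open>P\<close>. Vanishing at \<open>a\<close> allows the polynomial to be bounded by the
  integral of its derivative.\<close>

lemma polynomial_derivative_approximation:
  fixes g :: "real \<Rightarrow> real"
  assumes "continuous_on {a..b} g" "0 < e"
  shows "\<exists>p. poly p a = 0 \<and> (\<forall>t\<in>{a..b}. \<bar>poly (pderiv p) t - g t\<bar> < e)"
proof -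
  obtain f where f: "real_polynomial_function f" "\<And>t. t \<in> {a..b} \<Longrightarrow> \<bar>g t - f t\<bar> < e"
    using Stone_Weierstrass_real_polynomial_function[OF compact_Icc assms] by blast
  then obtain c n where fc: "f = (\<lambda>t. \<Sum>i\<le>n. c i * t ^ i)"
    by (auto simp: real_polynomial_function_iff_sum)
  define P where "P = (\<Sum>i\<le>n. monom (c i / real (Suc i)) (Suc i))"
  have "pderiv P = (\<Sum>i\<le>n. monom (c i) i)"
    unfolding P_def higher_pderiv_sum[of 1, simplified]
    by (intro sum.cong refl) (simp add: pderiv_monom del: of_nat_Suc)
  then have "poly (pderiv (P - [:poly P a:])) t = f t" for t
    by (simp add: pderiv_diff fc poly_sum poly_monom)
  then show ?thesis
    using f(2) by (intro exI[of _ "P - [:poly P a:]"]) (simp add: abs_minus_commute)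
qed

lemma integrable_tail_small:
  fixes f :: "real \<Rightarrow> real"
  assumes "integrable lborel f" "0 < e"
  shows "\<exists>R0. \<forall>R\<ge>R0. (\<integral>t. \<bar>f t\<bar> * indicator {t. R \<le> \<bar>t\<bar>} t \<partial>lborel) < e"
proof -
  have "((\<lambda>R. \<integral>t. \<bar>f t\<bar> * indicator {t. R \<le> \<bar>t\<bar>} t \<partial>lborel) \<longlongrightarrow> integral\<^sup>L (lborel :: real measure) (\<lambda>_. 0 :: real)) at_top"
  proof (rule integral_dominated_convergence_at_top[where w = "\<lambda>t. \<bar>f t\<bar>" and M = lborel
        and s = "\<lambda>R t. \<bar>f t\<bar> * indicator {t. R \<le> \<bar>t\<bar>} t" and f = "\<lambda>_. 0"])
    show "\<forall>\<^sub>F R in at_top. AE x in lborel. norm (\<bar>f x\<bar> * indicator {t. R \<le> \<bar>t\<bar>} x) \<le> \<bar>f x\<bar>"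
      by (auto simp: indicator_def abs_mult)
    show "AE x in lborel. ((\<lambda>R. \<bar>f x\<bar> * indicator {t. R \<le> \<bar>t\<bar>} x) \<longlongrightarrow> 0) at_top"
    proof (intro AE_I2 tendsto_eventually)
      fix x :: real
      show "\<forall>\<^sub>F R in at_top. \<bar>f x\<bar> * indicator {t. R \<le> \<bar>t\<bar>} x = 0"
        using eventually_gt_at_top[of "\<bar>x\<bar>"] by eventually_elim simp
    qed
  qed (use assms(1) in \<open>simp_all\<close>)
  then have "\<forall>\<^sub>F R in at_top. (\<integral>t. \<bar>f t\<bar> * indicator {t. R \<le> \<bar>t\<bar>} t \<partial>lborel) < e"
    by (rule order_tendstoD(2)) (simp add: assms(2))
  then show ?thesis
    by (simp add: eventually_at_top_linorder)
qed

section \<open>The spectral shift function\<close>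

lemma selfadjoint_add:
  assumes "selfadjoint A" "selfadjoint B"
  shows "selfadjoint (A + B)"
proof -
  have "cinner x (y + z) = cinner x y + cinner x z" for x y z :: "'a ell2"
    using cinner_add_left[of y z x] cinner_commute[of x] by simp
  then show ?thesis
    using assms by (simp add: selfadjoint_def blinfun.add_left cinner_add_left)
qed

text \<open>
  The test function is approximated by derivatives of polynomials times a cutoff: on such functions
  the functional calculus reduces to polynomials. The derivative of the cutoff only
  sees the tail of \<open>\<xi>\<close>, which is small when the interval is large.
\<close>

theorem spectral_shift_integral_bound:
  fixes A C :: "'a ell2 \<Rightarrow>\<^sub>L 'a ell2"
  assumes ssf: "is_spectral_shift A C \<xi>"
    and tr: "\<And>p R. norm A \<le> R \<Longrightarrow> norm (A + C) \<le> R \<Longrightarrow>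
      \<bar>Re (op_trace (poly_op p (A + C) - poly_op p A))\<bar>
        \<le> N * (\<integral>t. \<bar>poly (pderiv p) t\<bar> * indicator {-R..R} t \<partial>lborel)"
    and N: "0 \<le> N"
    and g: "continuous_on UNIV g" "bounded {t. g t \<noteq> 0}"
  shows "\<bar>\<integral>t. g t * \<xi> t \<partial>lborel\<bar> \<le> (N + 1) * (\<integral>t. \<bar>g t\<bar> \<partial>lborel)"
proof -
  have A: "selfadjoint A" and AC: "selfadjoint (A + C)" and \<xi>: "integrable lborel \<xi>"
    using ssf by (auto simp: is_spectral_shift_def selfadjoint_trace_class_def intro: selfadjoint_add)
  obtain R1 where R1: "\<And>t. g t \<noteq> 0 \<Longrightarrow> \<bar>t\<bar> \<le> R1"
    using g(2) by (auto simp: bounded_iff)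
  obtain K where K: "\<And>R t. \<bar>deriv (cutoff R) t\<bar> \<le> K"
    using deriv_cutoff_bounded by blast
  have K0: "0 \<le> K" using K[of 0 0] by linarith
  \<comment> \<open>This threshold for the tail gives \<open>K * \<tau> \<le> 1\<close>; writing
    \<open>K + 1\<close> avoids division by zero when \<open>K = 0\<close>.\<close>
  obtain R0 where R0: "\<And>R. R0 \<le> R \<Longrightarrow> (\<integral>t. \<bar>\<xi> t\<bar> * indicator {t. R \<le> \<bar>t\<bar>} t \<partial>lborel) < 1 / (K + 1)"
    using integrable_tail_small[OF \<xi>, of "1 / (K + 1)"] K0 by auto
  \<comment> \<open>\<open>g\<close> vanishes outside \<open>{- R..R}\<close>, the tail of
    \<open>\<xi>\<close> beyond \<open>R\<close> is small, and the interval covers those on which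
    both functional calculi are evaluated.\<close>
  define R where "R = Max {R0, R1, norm A, norm (A + C), 0}"
  have R: "R0 \<le> R" "R1 \<le> R" "norm A \<le> R" "norm (A + C) \<le> R" "0 \<le> R"
    by (auto simp: R_def le_max_iff_disj)
  define \<tau> where "\<tau> = (\<integral>t. \<bar>\<xi> t\<bar> * indicator {t. R \<le> \<bar>t\<bar>} t \<partial>lborel)"
  have int_tail: "integrable lborel (\<lambda>t. \<bar>\<xi> t\<bar> * indicator {t. R \<le> \<bar>t\<bar>} t)"
    using \<xi> by (intro integrable_real_mult_indicator integrable_abs) auto
  have \<tau>0: "0 \<le> \<tau>" unfolding \<tau>_def by (intro integral_nonneg_AE) auto
  have K\<tau>: "K * \<tau> \<le> 1"
  proof -
    have "K * \<tau> \<le> K * (1 / (K + 1))"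
      using R0[OF R(1)] K0 by (intro mult_left_mono) (auto simp: \<tau>_def)
    also have "\<dots> \<le> 1" using K0 by simp
    finally show ?thesis .
  qed
  define I where "I = (\<integral>t. \<bar>g t\<bar> \<partial>lborel)"
  define L where "L = (\<integral>t. \<bar>\<xi> t\<bar> \<partial>lborel)"
  have gind: "g t = g t * indicator {- S..S} t" if "R \<le> S" for t S
    using R1[of t] R(2) that by (auto simp: indicator_def abs_le_iff)
  have gint: "integrable lborel (\<lambda>t. \<bar>g t\<bar>)"
  proof -
    have "integrable lborel (\<lambda>t. \<bar>g t\<bar> * indicator {- R..R} t)"
      using g(1) by (intro borel_integrable_atLeastAtMost continuous_intros)
        (auto simp: continuous_on_eq_continuous_at)
    moreover have "\<bar>g t\<bar> * indicator {- R..R} t = \<bar>g t\<bar>" for t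
      using gind[OF order_refl, of t] by (auto simp: indicator_def)
    ultimately show ?thesis by simp
  qed
  have I0: "0 \<le> I" unfolding I_def by simp
  \<comment> \<open>\<open>e\<close> is the accuracy of the polynomial approximation. As
    \<open>e\<close> tends to 0 the right side becomes \<open>N * I + I * K * \<tau>\<close>, which
    is at most \<open>(N + 1) * I\<close>.\<close>
  have main: "\<bar>\<integral>t. g t * \<xi> t \<partial>lborel\<bar>
      \<le> N * (I + 2 * R * e) + e * L + (e + (I + 2 * (R + 1) * e) * K) * \<tau>" if e: "0 < e" for e
  proof -
    obtain p where p0: "poly p (- (R + 1)) = 0"
      and p: "\<And>t. t \<in> {- (R + 1)..R + 1} \<Longrightarrow> \<bar>poly (pderiv p) t - g t\<bar> < e"
      using polynomial_derivative_approximation[of "- (R + 1)" "R + 1" g e] g(1) e continuous_on_subset by blast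
    have pint: "integrable lborel (\<lambda>t. \<bar>poly (pderiv p) t\<bar> * indicator {- S..S} t)" for S
      by (rule borel_integrable_atLeastAtMost) (auto intro!: continuous_intros)
    have ind: "integrable lborel (indicator {- S..S} :: real \<Rightarrow> real)" for S :: real
      by (rule integrable_real_indicator) (auto simp: emeasure_lborel_Icc_eq)
    have pI: "(\<integral>t. \<bar>poly (pderiv p) t\<bar> * indicator {- S..S} t \<partial>lborel) \<le> I + 2 * S * e"
      if S: "R \<le> S" "S \<le> R + 1" for S
    proof -
      have "(\<integral>t. \<bar>poly (pderiv p) t\<bar> * indicator {- S..S} t \<partial>lborel)
          \<le> (\<integral>t. \<bar>g t\<bar> + e * indicator {- S..S} t \<partial>lborel)"
      proof (rule integral_mono[OF pint])
        show "integrable lborel (\<lambda>t. \<bar>g t\<bar> + e * indicator {- S..S} t)"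
          using gint ind by (intro Bochner_Integration.integrable_add integrable_mult_right)
        show "\<bar>poly (pderiv p) t\<bar> * indicator {- S..S} t \<le> \<bar>g t\<bar> + e * indicator {- S..S} t" for t
          using p[of t] S e by (auto simp: indicator_def)
      qed
      also have "\<dots> = I + 2 * S * e"
        using gint ind R(5) S unfolding I_def by (subst Bochner_Integration.integral_add) auto
      finally show ?thesis .
    qed
    \<comment> \<open>Since \<open>p\<close> vanishes at the left end, its size is bounded by the
      integral of its derivative, thus essentially by \<open>I\<close>; the cutoff term then costs
      only a multiple of \<open>I\<close>.\<close>
    have p_le: "\<bar>poly p t\<bar> \<le> I + 2 * (R + 1) * e" if t: "t \<in> {- (R + 1)..R + 1}" for t
    proof -
      have "(\<integral>s. poly (pderiv p) s * indicator {- (R + 1)..t} s \<partial>lborel) = poly p t - poly p (- (R + 1))"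
        using t by (intro integral_FTC_Icc_real) (auto intro!: poly_DERIV continuous_intros)
      then have "\<bar>poly p t\<bar> = \<bar>\<integral>s. poly (pderiv p) s * indicator {- (R + 1)..t} s \<partial>lborel\<bar>"
        by (simp only: p0 diff_0_right)
      also have "\<dots> \<le> (\<integral>s. \<bar>poly (pderiv p) s * indicator {- (R + 1)..t} s\<bar> \<partial>lborel)"
        by (rule integral_abs_bound)
      also have "\<dots> \<le> (\<integral>s. \<bar>poly (pderiv p) s\<bar> * indicator {- (R + 1)..R + 1} s \<partial>lborel)"
      proof (rule integral_mono[OF _ pint])
        show "integrable lborel (\<lambda>s. \<bar>poly (pderiv p) s * indicator {- (R + 1)..t} s\<bar>)"
          by (intro integrable_abs borel_integrable_atLeastAtMost) (auto intro!: continuous_intros)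
        show "\<bar>poly (pderiv p) s * indicator {- (R + 1)..t} s\<bar>
            \<le> \<bar>poly (pderiv p) s\<bar> * indicator {- (R + 1)..R + 1} s" for s
          using t by (auto simp: indicator_def)
      qed
      also have "\<dots> \<le> I + 2 * (R + 1) * e"
        by (rule pI) (use R in auto)
      finally show ?thesis .
    qed
    define \<phi> where "\<phi> t = poly p t * cutoff R t" for t
    have d\<phi>: "deriv \<phi> t = poly (pderiv p) t * cutoff R t + deriv (cutoff R) t * poly p t" for t
      unfolding \<phi>_def[abs_def] by (intro DERIV_imp_deriv DERIV_mult poly_DERIV cutoff_deriv)
    have "\<phi> \<in> C0_infinity"
      using poly_cutoff_C0_infinity[of p R] by (simp add: \<phi>_def[abs_def])
    then have "op_trace (fun_calc \<phi> (A + C) - fun_calc \<phi> A) = of_real (\<integral>t. deriv \<phi> t * \<xi> t \<partial>lborel)"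
      using ssf by (simp add: is_spectral_shift_def)
    moreover have "fun_calc \<phi> (A + C) = poly_op p (A + C)" "fun_calc \<phi> A = poly_op p A"
      using R by (auto intro!: fun_calc_poly[OF A] fun_calc_poly[OF AC] simp: \<phi>_def cutoff_eq_1)
    ultimately have "\<bar>\<integral>t. deriv \<phi> t * \<xi> t \<partial>lborel\<bar> = \<bar>Re (op_trace (poly_op p (A + C) - poly_op p A))\<bar>"
      by simp
    also have "\<dots> \<le> N * (\<integral>t. \<bar>poly (pderiv p) t\<bar> * indicator {- R..R} t \<partial>lborel)"
      by (rule tr[OF R(3,4)])
    also have "\<dots> \<le> N * (I + 2 * R * e)"
      using N by (intro mult_left_mono pI) auto
    finally have trace: "\<bar>\<integral>t. deriv \<phi> t * \<xi> t \<partial>lborel\<bar> \<le> N * (I + 2 * R * e)" .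
    define \<beta> where "\<beta> = e + (I + 2 * (R + 1) * e) * K"
    have \<beta>0: "0 \<le> \<beta>" using e I0 K0 R(5) by (simp add: \<beta>_def)
    \<comment> \<open>Inside \<open>R\<close> only the approximation error counts, and beyond
      \<open>R + 1\<close> both functions vanish. The cutoff acts only in between, where the larger
      error \<open>\<beta>\<close> will meet the tail of \<open>\<xi>\<close>.\<close>
    have pointwise: "\<bar>g t - deriv \<phi> t\<bar> \<le> e + \<beta> * indicator {t. R \<le> \<bar>t\<bar>} t" for t
    proof -
      consider "\<bar>t\<bar> < R" | "R \<le> \<bar>t\<bar>" "\<bar>t\<bar> \<le> R + 1" | "R + 1 < \<bar>t\<bar>" by linarith
      then show ?thesis
      proof cases
        case 1
        then have "deriv \<phi> t = poly (pderiv p) t"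
          by (simp add: d\<phi> cutoff_eq_1 deriv_cutoff_eq_0)
        moreover have "t \<in> {- (R + 1)..R + 1}" using 1 by auto
        ultimately show ?thesis using p[of t] 1 by auto
      next
        case 2
        then have t: "t \<in> {- (R + 1)..R + 1}" by auto
        have "g t - deriv \<phi> t = g t * (1 - cutoff R t) + (g t - poly (pderiv p) t) * cutoff R t
            - deriv (cutoff R) t * poly p t"
          by (simp add: d\<phi> algebra_simps)
        \<comment> \<open>Either \<open>g\<close> vanishes at \<open>t\<close>, or \<bar>t\<bar> =
          R, where the cutoff is still 1.\<close>
        moreover have "g t * (1 - cutoff R t) = 0"
        proof (cases "g t = 0")
          case False
          then have "\<bar>t\<bar> \<le> R" using R1[of t] R(2) by simp
          then show ?thesis by (simp add: cutoff_eq_1)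
        qed simp
        moreover have "\<bar>(g t - poly (pderiv p) t) * cutoff R t\<bar> \<le> e * 1"
          unfolding abs_mult using p[OF t] cutoff_bounds[of R t] e
          by (intro mult_mono) (auto simp: abs_minus_commute)
        moreover have "\<bar>deriv (cutoff R) t * poly p t\<bar> \<le> K * (I + 2 * (R + 1) * e)"
          unfolding abs_mult using K0 by (intro mult_mono K p_le t) auto
        ultimately have "\<bar>g t - deriv \<phi> t\<bar> \<le> \<beta>"
          by (simp add: \<beta>_def mult.commute)
        then show ?thesis using 2 e by simp
      next
        case 3
        then have "g t = 0" "deriv \<phi> t = 0"
          using R1[of t] R(2) by (auto simp: d\<phi> cutoff_eq_0 deriv_cutoff_eq_0)
        then show ?thesis using e \<beta>0 by (simp add: indicator_def)
      qed
    qed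
    have int\<phi>: "integrable lborel (\<lambda>t. deriv \<phi> t * \<xi> t)" and intg: "integrable lborel (\<lambda>t. g t * \<xi> t)"
    proof -
      have "continuous_on UNIV (cutoff R)" "continuous_on UNIV (deriv (cutoff R))"
        using smooth_upto_cutoff[of "Suc (Suc 0)" R]
        by (auto intro!: continuous_at_imp_continuous_on field_differentiable_imp_continuous_at)
      then have "continuous_on UNIV (deriv \<phi>)"
        unfolding d\<phi>[abs_def] by (intro continuous_intros)
      then have meas: "deriv \<phi> \<in> borel_measurable borel" "g \<in> borel_measurable borel"
        using g(1) by (auto intro: borel_measurable_continuous_onI)
      have "continuous_on {- R..R} (\<lambda>t. \<bar>g t\<bar>)"
        using continuous_on_subset[OF g(1)] by (intro continuous_intros) auto
      then have "bounded ((\<lambda>t. \<bar>g t\<bar>) ` {- R..R})"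
        by (intro compact_imp_bounded compact_continuous_image) auto
      then obtain M where M: "\<And>t. t \<in> {- R..R} \<Longrightarrow> \<bar>g t\<bar> \<le> M"
        by (force simp: bounded_iff)
      have gM: "\<bar>g t\<bar> \<le> \<bar>M\<bar>" for t
        using M[of t] gind[OF order_refl, of t] by (cases "t \<in> {- R..R}") auto
      have \<phi>M: "\<bar>deriv \<phi> t\<bar> \<le> \<bar>M\<bar> + (e + \<beta>)" for t
      proof -
        have "\<beta> * indicator {t. R \<le> \<bar>t\<bar>} t \<le> \<beta>"
          using \<beta>0 by (simp add: indicator_def)
        then show ?thesis using gM[of t] pointwise[of t] by linarith
      qed
      show "integrable lborel (\<lambda>t. g t * \<xi> t)"
      proof (rule Bochner_Integration.integrable_bound)
        show "integrable lborel (\<lambda>t. \<bar>M\<bar> * \<xi> t)" using \<xi> by simp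
        show "AE t in lborel. norm (g t * \<xi> t) \<le> norm (\<bar>M\<bar> * \<xi> t)"
          using gM by (auto simp: abs_mult intro!: mult_right_mono)
      qed (use meas \<xi> in measurable)
      show "integrable lborel (\<lambda>t. deriv \<phi> t * \<xi> t)"
      proof (rule Bochner_Integration.integrable_bound)
        show "integrable lborel (\<lambda>t. (\<bar>M\<bar> + (e + \<beta>)) * \<xi> t)" using \<xi> by simp
        show "AE t in lborel. norm (deriv \<phi> t * \<xi> t) \<le> norm ((\<bar>M\<bar> + (e + \<beta>)) * \<xi> t)"
          using \<phi>M e \<beta>0 by (auto simp: abs_mult intro!: mult_right_mono)
      qed (use meas \<xi> in measurable)
    qed
    have "\<bar>(\<integral>t. g t * \<xi> t \<partial>lborel) - (\<integral>t. deriv \<phi> t * \<xi> t \<partial>lborel)\<bar>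
        = \<bar>\<integral>t. g t * \<xi> t - deriv \<phi> t * \<xi> t \<partial>lborel\<bar>"
      by (simp add: Bochner_Integration.integral_diff[OF intg int\<phi>])
    also have "\<dots> \<le> (\<integral>t. \<bar>g t * \<xi> t - deriv \<phi> t * \<xi> t\<bar> \<partial>lborel)"
      by (rule integral_abs_bound)
    also have "\<dots> \<le> (\<integral>t. e * \<bar>\<xi> t\<bar> + \<beta> * (\<bar>\<xi> t\<bar> * indicator {t. R \<le> \<bar>t\<bar>} t) \<partial>lborel)"
    proof (rule integral_mono)
      show "integrable lborel (\<lambda>t. \<bar>g t * \<xi> t - deriv \<phi> t * \<xi> t\<bar>)"
        using intg int\<phi> by (intro integrable_abs Bochner_Integration.integrable_diff)
      show "integrable lborel (\<lambda>t. e * \<bar>\<xi> t\<bar> + \<beta> * (\<bar>\<xi> t\<bar> * indicator {t. R \<le> \<bar>t\<bar>} t))"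
        using \<xi> int_tail by (intro Bochner_Integration.integrable_add integrable_mult_right integrable_abs)
      fix t
      have "\<bar>g t * \<xi> t - deriv \<phi> t * \<xi> t\<bar> = \<bar>g t - deriv \<phi> t\<bar> * \<bar>\<xi> t\<bar>"
        by (simp add: left_diff_distrib[symmetric] abs_mult)
      also have "\<dots> \<le> (e + \<beta> * indicator {t. R \<le> \<bar>t\<bar>} t) * \<bar>\<xi> t\<bar>"
        using pointwise by (rule mult_right_mono) simp
      finally show "\<bar>g t * \<xi> t - deriv \<phi> t * \<xi> t\<bar>
          \<le> e * \<bar>\<xi> t\<bar> + \<beta> * (\<bar>\<xi> t\<bar> * indicator {t. R \<le> \<bar>t\<bar>} t)"
        by (simp add: algebra_simps)
    qed
    also have "\<dots> = e * L + \<beta> * \<tau>"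
      using \<xi> int_tail unfolding L_def \<tau>_def
      by (subst Bochner_Integration.integral_add) auto
    finally show ?thesis
      using trace unfolding \<beta>_def[symmetric] by linarith
  qed
  \<comment> \<open>The sum of all coefficients of \<open>e\<close> in \<open>main\<close>, so that
    the error there is \<open>e * M\<close>.\<close>
  define M where "M = 2 * N * R + L + \<tau> + 2 * (R + 1) * K * \<tau>"
  have L0: "0 \<le> L" unfolding L_def by simp
  have M0: "0 \<le> M"
    using N R(5) L0 \<tau>0 K0 by (simp add: M_def)
  have "\<bar>\<integral>t. g t * \<xi> t \<partial>lborel\<bar> \<le> (N + 1) * I"
  proof (rule field_le_epsilon)
    fix \<delta> :: real assume \<delta>: "0 < \<delta>"
    define e where "e = \<delta> / (M + 1)"
    have "0 < e" using \<delta> M0 by (simp add: e_def)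
    note main[OF this]
    also have "N * (I + 2 * R * e) + e * L + (e + (I + 2 * (R + 1) * e) * K) * \<tau>
        = N * I + I * (K * \<tau>) + e * M"
      by (simp add: M_def algebra_simps)
    also have "\<dots> \<le> N * I + I * 1 + e * M"
      using mult_left_mono[OF K\<tau> I0] by simp
    also have "e * M \<le> \<delta>"
      using \<delta> M0 by (simp add: e_def field_simps)
    finally show "\<bar>\<integral>t. g t * \<xi> t \<partial>lborel\<bar> \<le> (N + 1) * I + \<delta>"
      by (simp add: algebra_simps)
  qed
  then show ?thesis by (simp add: I_def)
qed

section \<open>Absolute continuity\<close>

lemma C0_1_I:
  assumes "\<And>x. (g has_real_derivative g' x) (at x)" "continuous_on UNIV g'" "bounded {x. g x \<noteq> 0}"
  shows "g \<in> C0_1"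
  using assms unfolding C0_1_def C1_differentiable_on_def
  by (auto simp: has_real_derivative_iff_has_vector_derivative)

lemma C0_1_D:
  assumes "g \<in> C0_1"
  shows "continuous_on UNIV g" "bounded {x. g x \<noteq> 0}"
  using assms by (auto simp: C0_1_def intro: C1_differentiable_imp_continuous_on)

text \<open>The tent functions \<open>f n\<close> converge to the indicator but need not be
  differentiable. Polynomials close to them, multiplied by a cutoff, are C1 and keep the limit
  because the error is at most \<open>1 / real (Suc n)\<close>.\<close>

lemma indicator_compact_approximation:
  fixes A :: "real set"
  assumes A: "compact A" "A \<noteq> {}"
  shows "\<exists>(g :: nat \<Rightarrow> real \<Rightarrow> real) r. (\<forall>n. g n \<in> C0_1) \<and>
    (\<forall>n t. \<bar>g n t\<bar> \<le> 2 * indicator {-r..r} t) \<and> (\<forall>t. (\<lambda>n. g n t) \<longlonglongrightarrow> indicator A t)"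
proof -
  obtain m where m: "\<And>t. t \<in> A \<Longrightarrow> \<bar>t\<bar> \<le> m"
    using compact_imp_bounded[OF A(1)] by (auto simp: bounded_iff)
  define f where "f n t = max 0 (1 - real (Suc n) * infdist t A)" for n t
  have f01: "0 \<le> f n t" "f n t \<le> 1" for n t
    by (simp_all add: f_def infdist_nonneg)
  have "\<exists>p. \<forall>t\<in>{- (m + 2)..m + 2}. \<bar>poly p t - f n t\<bar> < 1 / real (Suc n)" for n
  proof -
    have "continuous_on {- (m + 2)..m + 2} (f n)"
      unfolding f_def by (intro continuous_intros)
    from polynomial_derivative_approximation[OF this, of "1 / real (Suc n)"] show ?thesis
      by auto
  qed
  then obtain p where p: "\<And>n t. t \<in> {- (m + 2)..m + 2} \<Longrightarrow> \<bar>poly (p n) t - f n t\<bar> < 1 / real (Suc n)"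
    by metis
  \<comment> \<open>The cutoff is 1 on \<open>{- (m + 1)..m + 1}\<close>; outside this interval the
    distance to \<open>A\<close> is at least 1 and \<open>f n\<close> vanishes.\<close>
  define g where "g n t = poly (p n) t * cutoff (m + 1) t" for n t
  have supp: "g n t = 0" if "m + 2 \<le> \<bar>t\<bar>" for n t
    using cutoff_eq_0[of "m + 1" t] that by (simp add: g_def)
  have far: "f n t = 0" if t: "m + 1 < \<bar>t\<bar>" for n t
  proof -
    have "1 \<le> infdist t A"
      unfolding infdist_notempty[OF A(2)]
    proof (rule cINF_greatest[OF A(2)])
      show "1 \<le> dist t a" if "a \<in> A" for a
        using m[OF that] t by (simp add: dist_real_def)
    qed
    then have "1 * 1 \<le> real (Suc n) * infdist t A"
      by (intro mult_mono) auto
    then show ?thesis by (simp add: f_def)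
  qed
  have g_f: "\<bar>g n t - f n t\<bar> \<le> 1 / real (Suc n)" for n t
  proof -
    consider "\<bar>t\<bar> \<le> m + 1" | "m + 1 < \<bar>t\<bar>" "\<bar>t\<bar> \<le> m + 2" | "m + 2 < \<bar>t\<bar>" by linarith
    then show ?thesis
    proof cases
      case 1
      then have "t \<in> {- (m + 2)..m + 2}" by auto
      from p[OF this, of n] show ?thesis using 1 by (simp add: g_def cutoff_eq_1)
    next
      case 2
      have "t \<in> {- (m + 2)..m + 2}" using 2 by auto
      then have "\<bar>poly (p n) t\<bar> \<le> 1 / real (Suc n)"
        using p[of t n] far[OF 2(1), of n] by simp
      moreover have "\<bar>poly (p n) t\<bar> * cutoff (m + 1) t \<le> \<bar>poly (p n) t\<bar> * 1"
        using cutoff_bounds by (intro mult_left_mono) auto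
      ultimately show ?thesis
        using cutoff_bounds(1)[of "m + 1" t] by (simp add: g_def abs_mult far[OF 2(1)])
    next
      case 3
      then show ?thesis by (simp add: far supp)
    qed
  qed
  have "g n \<in> C0_1" for n
  proof (rule C0_1_I)
    show "(g n has_real_derivative
        poly (pderiv (p n)) t * cutoff (m + 1) t + deriv (cutoff (m + 1)) t * poly (p n) t) (at t)" for t
      unfolding g_def[abs_def] by (intro DERIV_mult poly_DERIV cutoff_deriv)
    have "continuous_on UNIV (cutoff (m + 1))" "continuous_on UNIV (deriv (cutoff (m + 1)))"
      using smooth_upto_cutoff[of "Suc (Suc 0)" "m + 1"]
      by (auto intro!: continuous_at_imp_continuous_on field_differentiable_imp_continuous_at)
    then show "continuous_on UNIV (\<lambda>t. poly (pderiv (p n)) t * cutoff (m + 1) t + deriv (cutoff (m + 1)) t * poly (p n) t)"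
      by (intro continuous_intros)
    have "{t. g n t \<noteq> 0} \<subseteq> {- (m + 2)..m + 2}"
    proof
      fix t assume "t \<in> {t. g n t \<noteq> 0}"
      then have "\<not> m + 2 \<le> \<bar>t\<bar>" using supp[of t n] by auto
      then show "t \<in> {- (m + 2)..m + 2}" by auto
    qed
    then show "bounded {t. g n t \<noteq> 0}"
      by (rule bounded_subset[rotated]) simp
  qed
  moreover have "\<bar>g n t\<bar> \<le> 2 * indicator {- (m + 2)..m + 2} t" for n t
  proof (cases "t \<in> {- (m + 2)..m + 2}")
    case True
    \<comment> \<open>Origin of the 2 in the bound: \<open>f n\<close> is at most 1 and so is the
      error.\<close>
    have "1 / real (Suc n) \<le> 1" by simp
    then have "\<bar>g n t\<bar> \<le> 2"
      using g_f[of n t] f01[of n t] by linarith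
    then show ?thesis using True by simp
  next
    case False
    then have "m + 2 \<le> \<bar>t\<bar>" by auto
    then show ?thesis using False by (simp add: supp)
  qed
  moreover have "(\<lambda>n. g n t) \<longlonglongrightarrow> indicator A t" for t
  proof -
    have "(\<lambda>n. 1 / real (Suc n)) \<longlonglongrightarrow> 0"
      using LIMSEQ_inverse_real_of_nat by (simp add: inverse_eq_divide)
    then have "(\<lambda>n. g n t - f n t) \<longlonglongrightarrow> 0"
      by (rule Lim_null_comparison[rotated]) (use g_f in \<open>auto intro!: always_eventually\<close>)
    moreover have "(\<lambda>n. f n t) \<longlonglongrightarrow> indicator A t"
    proof (cases "t \<in> A")
      case True
      then show ?thesis by (simp add: f_def)
    next
      case False
      then have pos: "0 < infdist t A"
        using A compact_imp_closed infdist_pos_not_in_closed by blast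
      have "\<forall>\<^sub>F n in sequentially. f n t = 0"
      proof -
        obtain k :: nat where k: "1 < real k * infdist t A"
          using reals_Archimedean3[OF pos] by blast
        have "f n t = 0" if "k \<le> n" for n
        proof -
          have "real k * infdist t A \<le> real (Suc n) * infdist t A"
            using that pos by (intro mult_right_mono) auto
          then show ?thesis using k by (simp add: f_def)
        qed
        then show ?thesis by (auto simp: eventually_sequentially)
      qed
      then show ?thesis using False by (simp add: tendsto_eventually)
    qed
    ultimately have "(\<lambda>n. (g n t - f n t) + f n t) \<longlonglongrightarrow> 0 + indicator A t"
      by (rule tendsto_add)
    then show ?thesis by simp
  qed
  ultimately show ?thesis by blast
qed

text \<open>Dominated convergence along the approximations of the indicator of \<open>A\<close>; the
  common bound is integrable for all three measures, as each is finite on bounded intervals.\<close>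

lemma measure_compact_le:
  fixes \<mu> \<nu> :: "real measure"
  assumes \<mu>: "sets \<mu> = sets borel" "\<And>r. emeasure \<mu> {-r..r} < \<infinity>"
    and \<nu>: "sets \<nu> = sets borel" "\<And>r. emeasure \<nu> {-r..r} < \<infinity>"
    and le: "\<And>g. g \<in> C0_1 \<Longrightarrow> (\<integral>t. g t \<partial>\<mu>) - (\<integral>t. g t \<partial>\<nu>) \<le> K * (\<integral>t. \<bar>g t\<bar> \<partial>lborel)"
    and A: "compact A"
  shows "measure \<mu> A - measure \<nu> A \<le> K * measure lborel A"
proof (cases "A = {}")
  case False
  obtain g :: "nat \<Rightarrow> real \<Rightarrow> real" and r where g: "\<And>n. g n \<in> C0_1"
    and bnd: "\<And>n t. \<bar>g n t\<bar> \<le> 2 * indicator {-r..r} t"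
    and lim: "\<And>t. (\<lambda>n. g n t) \<longlonglongrightarrow> indicator A t"
    using indicator_compact_approximation[OF A False] by blast
  have Ab: "A \<in> sets borel" using A by (simp add: compact_imp_closed)
  have gm: "g n \<in> borel_measurable borel" for n
    using C0_1_D(1)[OF g] by (rule borel_measurable_continuous_onI)
  have conv: "(\<lambda>n. \<integral>t. g n t \<partial>\<rho>) \<longlonglongrightarrow> measure \<rho> A" "(\<lambda>n. \<integral>t. \<bar>g n t\<bar> \<partial>\<rho>) \<longlonglongrightarrow> measure \<rho> A"
    if \<rho>: "sets \<rho> = sets borel" "emeasure \<rho> {-r..r} < \<infinity>" for \<rho> :: "real measure"
  proof -
    have meas: "f \<in> borel_measurable \<rho>" if "f \<in> borel_measurable borel" for f :: "real \<Rightarrow> real"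
      using that measurable_cong_sets[OF \<rho>(1) refl] by blast
    have sp: "space \<rho> = UNIV" using sets_eq_imp_space_eq[OF \<rho>(1)] by simp
    have w: "integrable \<rho> (\<lambda>t. 2 * indicator {-r..r} t :: real)"
      by (intro integrable_mult_right integrable_real_indicator) (use \<rho> in simp_all)
    have lim': "(\<lambda>n. \<bar>g n t\<bar>) \<longlonglongrightarrow> indicator A t" for t
      using tendsto_rabs[OF lim[of t]] by simp
    have "(\<lambda>n. \<integral>t. g n t \<partial>\<rho>) \<longlonglongrightarrow> (\<integral>t. indicator A t \<partial>\<rho>)"
      using lim bnd by (intro integral_dominated_convergence[OF _ _ w] meas gm)
        (auto simp: Ab intro!: borel_measurable_indicator)
    then show "(\<lambda>n. \<integral>t. g n t \<partial>\<rho>) \<longlonglongrightarrow> measure \<rho> A" by (simp add: sp)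
    have "(\<lambda>n. \<integral>t. \<bar>g n t\<bar> \<partial>\<rho>) \<longlonglongrightarrow> (\<integral>t. indicator A t \<partial>\<rho>)"
      using lim' bnd gm by (intro integral_dominated_convergence[OF _ _ w] meas)
        (auto simp: Ab intro!: borel_measurable_indicator)
    then show "(\<lambda>n. \<integral>t. \<bar>g n t\<bar> \<partial>\<rho>) \<longlonglongrightarrow> measure \<rho> A" by (simp add: sp)
  qed
  show ?thesis
  proof (rule LIMSEQ_le)
    show "(\<lambda>n. (\<integral>t. g n t \<partial>\<mu>) - (\<integral>t. g n t \<partial>\<nu>)) \<longlonglongrightarrow> measure \<mu> A - measure \<nu> A"
      by (intro tendsto_diff conv \<mu> \<nu>)
    show "(\<lambda>n. K * (\<integral>t. \<bar>g n t\<bar> \<partial>lborel)) \<longlonglongrightarrow> K * measure lborel A"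
      by (intro tendsto_mult_left conv) (simp_all add: emeasure_lborel_Icc_eq)
  qed (use le g in auto)
qed simp

text \<open>On subsets of \<open>S\<close> the measure \<open>\<nu>\<close> vanishes, so no
  cancellation can occur there: for a compact Lebesgue null set in \<open>S\<close> the inequality
  leaves \<open>measure \<mu> A \<le> 0\<close>. Approximation from inside by compact sets extends
  this to Borel sets.\<close>

lemma absolutely_continuous_lborel_singular_part:
  fixes \<mu> \<nu> :: "real measure"
  assumes \<mu>: "sets \<mu> = sets borel" "\<And>r. emeasure \<mu> {-r..r} < \<infinity>"
    and \<nu>: "sets \<nu> = sets borel" "\<And>r. emeasure \<nu> {-r..r} < \<infinity>"
    and S: "S \<in> sets borel" "emeasure \<mu> (- S) = 0" "emeasure \<nu> S = 0"
    and le: "\<And>g. g \<in> C0_1 \<Longrightarrow> (\<integral>t. g t \<partial>\<mu>) - (\<integral>t. g t \<partial>\<nu>) \<le> K * (\<integral>t. \<bar>g t\<bar> \<partial>lborel)"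
  shows "absolutely_continuous lborel \<mu>"
  unfolding absolutely_continuous_def
proof
  fix B :: "real set" assume "B \<in> null_sets lborel"
  then have B: "B \<in> sets borel" "emeasure lborel B = 0" by auto
  have bounded_part: "emeasure \<mu> (B \<inter> S \<inter> {-r..r}) = 0" for r :: real
  proof -
    let ?B = "B \<inter> S \<inter> {-r..r}"
    \<comment> \<open>Inner regularity is applied to a finite measure, hence the restriction to a
      bounded interval.\<close>
    define \<rho> where "\<rho> = density \<mu> (indicator {-r..r})"
    have emu: "emeasure \<rho> X = emeasure \<mu> (X \<inter> {-r..r})" if "X \<in> sets borel" for X
      using that \<mu>(1) unfolding \<rho>_def
      by (subst emeasure_restricted) (auto simp: Int_commute)
    have sp: "space \<rho> = UNIV" using sets_eq_imp_space_eq[OF \<mu>(1)] by (simp add: \<rho>_def)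
    have "emeasure \<rho> ?B = (SUP A \<in> {A. A \<subseteq> ?B \<and> compact A}. emeasure \<rho> A)"
    proof (rule inner_regular)
      show "sets \<rho> = sets borel" using \<mu>(1) by (simp add: \<rho>_def)
      show "emeasure \<rho> (space \<rho>) \<noteq> \<infinity>"
        using emu[of UNIV] \<mu>(2)[of r] by (simp add: sp)
      show "?B \<in> sets borel" using B S by auto
    qed
    also have "\<dots> = 0"
    proof (rule antisym[OF SUP_least])
      fix A assume "A \<in> {A. A \<subseteq> ?B \<and> compact A}"
      then have A: "A \<subseteq> ?B" "compact A" by auto
      have Ab: "A \<in> sets borel" using A by (simp add: compact_imp_closed)
      have "emeasure \<nu> A = 0"
        by (rule emeasure_eq_0[of S]) (use A S \<nu>(1) in auto)
      moreover have "emeasure lborel A = 0"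
        by (rule emeasure_eq_0[of B]) (use A B in auto)
      ultimately have "measure \<nu> A = 0" "measure lborel A = 0"
        by (simp_all add: measure_def)
      then have "measure \<mu> A \<le> 0"
        using measure_compact_le[OF \<mu> \<nu> le A(2)] by simp
      moreover have "emeasure \<mu> A \<le> emeasure \<mu> {-r..r}"
        using A \<mu>(1) by (intro emeasure_mono) auto
      then have "emeasure \<mu> A < \<infinity>"
        using \<mu>(2)[of r] by simp
      then have "emeasure \<mu> A = ennreal (measure \<mu> A)"
        by (simp add: emeasure_eq_ennreal_measure)
      ultimately have "emeasure \<mu> A = 0"
        by (simp add: ennreal_neg)
      then show "emeasure \<rho> A \<le> 0"
        using emu[OF Ab] A by (simp add: Int_absorb2)
    qed simp
    finally show ?thesis
      using emu[of ?B] B S by (simp add: Int_absorb2 Int_assoc)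
  qed
  have "B \<inter> S = (\<Union>n. B \<inter> S \<inter> {- real n..real n})"
  proof (intro equalityI subsetI)
    fix t assume "t \<in> B \<inter> S"
    moreover obtain n :: nat where "\<bar>t\<bar> \<le> real n" using real_arch_simple by blast
    ultimately show "t \<in> (\<Union>n. B \<inter> S \<inter> {- real n..real n})"
      by (auto simp: abs_le_iff intro!: exI[of _ n])
  qed auto
  moreover have "(\<Union>n. B \<inter> S \<inter> {- real n..real n}) \<in> null_sets \<mu>"
    using bounded_part B S \<mu>(1) by (intro null_sets_UN) (auto simp: null_sets_def)
  ultimately have "B \<inter> S \<in> null_sets \<mu>" by simp
  moreover have "B \<inter> - S \<in> null_sets \<mu>"
    by (rule null_sets_subset[of "- S"]) (use S B \<mu>(1) in \<open>auto simp: null_sets_def\<close>)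
  ultimately have "(B \<inter> S) \<union> (B \<inter> - S) \<in> null_sets \<mu>"
    by (rule null_sets.Un)
  moreover have "(B \<inter> S) \<union> (B \<inter> - S) = B" by blast
  ultimately show "B \<in> null_sets \<mu>" by simp
qed

text \<open>The bound is symmetric in the two Jordan parts, so each can be treated as the singular
  part, on the carriers \<open>S\<close> and \<open>- S\<close>.\<close>

lemma signed_absolutely_continuous_lborelI:
  assumes \<Xi>: "signed_borel_measure \<Xi>"
    and le: "\<And>g. g \<in> C0_1 \<Longrightarrow> \<bar>signed_integral \<Xi> g\<bar> \<le> K * (\<integral>t. \<bar>g t\<bar> \<partial>lborel)"
  shows "signed_absolutely_continuous lborel \<Xi>"
proof -
  have sets: "sets (fst \<Xi>) = sets borel" "sets (snd \<Xi>) = sets borel"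
    and fin: "emeasure (fst \<Xi>) {-r..r} < \<infinity>" "emeasure (snd \<Xi>) {-r..r} < \<infinity>" for r
    using \<Xi> by (auto simp: signed_borel_measure_def)
  obtain S where S: "S \<in> sets borel" "emeasure (fst \<Xi>) (- S) = 0" "emeasure (snd \<Xi>) S = 0"
    using \<Xi> by (auto simp: signed_borel_measure_def)
  have "absolutely_continuous lborel (fst \<Xi>)"
    by (rule absolutely_continuous_lborel_singular_part[OF sets(1) fin(1) sets(2) fin(2) S, of K])
       (use le in \<open>force simp: signed_integral_def\<close>)
  moreover have "absolutely_continuous lborel (snd \<Xi>)"
    by (rule absolutely_continuous_lborel_singular_part[OF sets(2) fin(2) sets(1) fin(1), of "- S" K])
       (use le S in \<open>force simp: signed_integral_def\<close>)+
  ultimately show ?thesis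
    by (simp add: signed_absolutely_continuous_def)
qed

section \<open>Lattice boxes\<close>

text \<open>The added 0 makes the relation reflexive, so that its \<open>d\<close>-th power
  comprises all pairs at distance at most \<open>d\<close>.\<close>

definition lattice_adjacency :: "('n::finite, 'm::finite) lattice rel"
  where "lattice_adjacency = {(a, b). b - a \<in> insert 0 neighbours}"

lemma uminus_neighbours: "- j \<in> neighbours \<longleftrightarrow> j \<in> neighbours"
  by (simp add: neighbours_def)

lemma lattice_adjacency_Image: "lattice_adjacency `` {a} = (\<lambda>j. a + j) ` insert 0 neighbours"
proof (intro set_eqI iffI)
  fix b assume "b \<in> lattice_adjacency `` {a}"
  then have "b - a \<in> insert 0 neighbours" by (auto simp: lattice_adjacency_def)
  moreover have "b = a + (b - a)" by simp
  ultimately show "b \<in> (\<lambda>j. a + j) ` insert 0 neighbours" by blast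
qed (auto simp: lattice_adjacency_def)

lemma sym_lattice_adjacency: "sym (lattice_adjacency :: ('n::finite, 'm::finite) lattice rel)"
proof (rule symI)
  fix a b :: "('n, 'm) lattice" assume "(a, b) \<in> lattice_adjacency"
  then have "b - a = 0 \<or> b - a \<in> neighbours" by (auto simp: lattice_adjacency_def)
  then have "a - b = 0 \<or> - (b - a) \<in> neighbours"
    unfolding uminus_neighbours by auto
  then show "(b, a) \<in> lattice_adjacency" by (simp add: lattice_adjacency_def)
qed

lemma h0_ket: "blinfun_apply h0 (ket a) = (\<Sum>j\<in>neighbours. ket (a + j))"
  by (rule ell2_eqI) (auto simp: coord_h0 coord_sum finite_neighbours coord_ket algebra_simps intro!: sum.cong)

lemma h0_ket_in_span: "blinfun_apply h0 (ket a) \<in> span (ket ` (lattice_adjacency `` {a}))"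
  unfolding h0_ket lattice_adjacency_Image by (intro span_sum span_base) auto

lemma V_box_ket:
  "blinfun_apply (V_box v (lattice_box a b)) (ket c) =
    (if real_vec (fst c) \<in> lattice_box a b then surface_potential v c else 0) *\<^sub>R ket c"
  by (rule ell2_eqI) (simp add: coord_V_box coord_ket scaleR_conv_of_real)

lemma card_lattice_box:
  fixes a b :: "int ^ 'n::finite"
  shows "finite {x. real_vec x \<in> lattice_box a b}"
    and "card {x. real_vec x \<in> lattice_box a b} = (\<Prod>i\<in>UNIV. nat (b $ i - a $ i + 1))"
proof -
  have bij: "bij_betw vec_nth {x. real_vec x \<in> lattice_box a b} (PiE UNIV (\<lambda>i. {a $ i..b $ i}))"
  proof (rule bij_betwI[where g = vec_lambda])
    show "vec_nth \<in> {x. real_vec x \<in> lattice_box a b} \<rightarrow> PiE UNIV (\<lambda>i. {a $ i..b $ i})"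
      by (auto simp: lattice_box_def real_vec_def mem_box_cart)
    show "vec_lambda \<in> PiE UNIV (\<lambda>i. {a $ i..b $ i}) \<rightarrow> {x. real_vec x \<in> lattice_box a b}"
      by (auto simp: lattice_box_def real_vec_def mem_box_cart)
  qed (auto simp: vec_lambda_eta)
  show "finite {x. real_vec x \<in> lattice_box a b}"
    using bij_betw_finite[OF bij] by (simp add: finite_PiE)
  show "card {x. real_vec x \<in> lattice_box a b} = (\<Prod>i\<in>UNIV. nat (b $ i - a $ i + 1))"
    using bij_betw_same_card[OF bij] by (simp add: card_PiE algebra_simps)
qed

lemma measure_lattice_box:
  fixes a b :: "int ^ 'n::finite"
  assumes "\<And>i. a $ i \<le> b $ i"
  shows "measure lborel (lattice_box a b) = (\<Prod>i\<in>UNIV. real_of_int (b $ i - a $ i))"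
proof -
  have "real_vec a \<in> cbox (real_vec a) (real_vec b)"
    using assms by (auto simp: real_vec_def mem_box_cart)
  then have "cbox (real_vec a) (real_vec b) \<noteq> {}" by blast
  then show ?thesis
    unfolding lattice_box_def by (subst content_cbox_cart) (simp_all add: real_vec_def)
qed

text \<open>The bound by \<open>card S + 1\<close> is divided by the volume; sides of length at
  least 1 give volume at least 1, which absorbs the summand 1.\<close>

theorem box_spectral_shift_bound:
  fixes v :: "int ^ 'n::finite \<Rightarrow> real"
  assumes ssf: "is_spectral_shift (h0 :: ('n, 'm::finite) lattice ell2 \<Rightarrow>\<^sub>L ('n, 'm) lattice ell2)
      (V_box v (lattice_box a b)) \<xi>"
    and ab: "\<And>i. a $ i + 1 \<le> b $ i"
    and g: "continuous_on UNIV g" "bounded {t. g t \<noteq> 0}"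
  shows "\<bar>1 / measure lborel (lattice_box a b) * (\<integral>t. g t * \<xi> t \<partial>lborel)\<bar>
    \<le> (2 ^ CARD('n) + 1) * (\<integral>t. \<bar>g t\<bar> \<partial>lborel)"
proof -
  let ?C = "V_box v (lattice_box a b) :: ('n, 'm) lattice ell2 \<Rightarrow>\<^sub>L ('n, 'm) lattice ell2"
  define F where "F = {x :: int ^ 'n. real_vec x \<in> lattice_box a b}"
  \<comment> \<open>The potential lives on the surface only, so the number of sites grows like the
    volume of the box in the surface.\<close>
  define S where "S = F \<times> {0 :: int ^ 'm}"
  define \<Lambda> where "\<Lambda> = measure lborel (lattice_box a b)"
  have sa: "selfadjoint (h0 :: ('n, 'm) lattice ell2 \<Rightarrow>\<^sub>L ('n, 'm) lattice ell2)" "selfadjoint (h0 + ?C)"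
    using ssf by (auto simp: is_spectral_shift_def selfadjoint_trace_class_def intro: selfadjoint_add)
  have "finite S"
    unfolding S_def F_def by (intro finite_cartesian_product card_lattice_box(1)) simp
  have "\<bar>\<integral>t. g t * \<xi> t \<partial>lborel\<bar> \<le> (real (card S) + 1) * (\<integral>t. \<bar>g t\<bar> \<partial>lborel)"
  proof (rule spectral_shift_integral_bound[OF ssf _ _ g])
    fix p R
    assume R: "norm (h0 :: ('n, 'm) lattice ell2 \<Rightarrow>\<^sub>L ('n, 'm) lattice ell2) \<le> R" "norm (h0 + ?C) \<le> R"
    show "\<bar>Re (op_trace (poly_op p (h0 + ?C) - poly_op p h0))\<bar>
        \<le> real (card S) * (\<integral>t. \<bar>poly (pderiv p) t\<bar> * indicator {-R..R} t \<partial>lborel)"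
    proof (rule op_trace_poly_bound[OF sa _ sym_lattice_adjacency _ h0_ket_in_span \<open>finite S\<close> _ _ R])
      show "(c, c) \<in> lattice_adjacency" for c :: "('n, 'm) lattice"
        by (simp add: lattice_adjacency_def)
      show "finite (lattice_adjacency `` {c})" for c :: "('n, 'm) lattice"
        by (simp add: lattice_adjacency_Image finite_neighbours)
      show "blinfun_apply ?C (ket c) = 0" if "c \<notin> S" for c
        using that by (auto simp: V_box_ket S_def F_def surface_potential_def mem_Times_iff)
      show "blinfun_apply ?C (ket c) \<in> span {ket c}" for c
        unfolding V_box_ket by (intro span_scale span_base) simp
    qed
  qed simp
  moreover have \<Lambda>: "\<Lambda> = (\<Prod>i\<in>UNIV. real_of_int (b $ i - a $ i))"
    unfolding \<Lambda>_def
  proof (rule measure_lattice_box)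
    show "a $ i \<le> b $ i" for i using ab[of i] by linarith
  qed
  have "1 \<le> \<Lambda>"
    unfolding \<Lambda>
  proof (rule prod_ge_1)
    show "1 \<le> real_of_int (b $ i - a $ i)" for i using ab[of i] by linarith
  qed
  have "real (card S) + 1 \<le> (2 ^ CARD('n) + 1) * \<Lambda>"
  proof -
    have "real (card S) = (\<Prod>i\<in>UNIV. real (nat (b $ i - a $ i + 1)))"
      using card_lattice_box(2)[of a b] by (simp add: S_def F_def card_cartesian_product)
    \<comment> \<open>A side of length \<open>l\<close> contains \<open>l + 1\<close> lattice
      points, at most \<open>2 * l\<close> because \<open>l\<close> is at least 1. This is the
      source of \<open>2 ^ CARD('n)\<close>.\<close>
    also have "\<dots> \<le> (\<Prod>i\<in>UNIV. 2 * real_of_int (b $ i - a $ i))"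
    proof (rule prod_mono)
      fix i
      have "real (nat (b $ i - a $ i + 1)) = real_of_int (b $ i) - real_of_int (a $ i) + 1"
        using ab[of i] by simp
      moreover have "real_of_int (a $ i) + 1 \<le> real_of_int (b $ i)"
        using ab[of i] by linarith
      ultimately show "0 \<le> real (nat (b $ i - a $ i + 1)) \<and>
          real (nat (b $ i - a $ i + 1)) \<le> 2 * real_of_int (b $ i - a $ i)"
        by simp
    qed
    also have "\<dots> = 2 ^ CARD('n) * \<Lambda>"
      unfolding \<Lambda> prod.distrib by simp
    finally show ?thesis using \<open>1 \<le> \<Lambda>\<close> by (simp add: algebra_simps)
  qed
  then have "(real (card S) + 1) * (\<integral>t. \<bar>g t\<bar> \<partial>lborel)
      \<le> ((2 ^ CARD('n) + 1) * \<Lambda>) * (\<integral>t. \<bar>g t\<bar> \<partial>lborel)"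
    by (rule mult_right_mono) simp
  ultimately have "\<bar>\<integral>t. g t * \<xi> t \<partial>lborel\<bar> \<le> \<Lambda> * ((2 ^ CARD('n) + 1) * (\<integral>t. \<bar>g t\<bar> \<partial>lborel))"
    by (simp add: mult_ac)
  then show ?thesis
    using \<open>1 \<le> \<Lambda>\<close> unfolding \<Lambda>_def[symmetric] by (simp add: abs_mult divide_le_eq mult_ac)
qed

section \<open>The limit over growing boxes\<close>

lemma eventually_boxes_to_infinity:
  "\<forall>\<^sub>F \<Lambda> in boxes_to_infinity. \<exists>a b. \<Lambda> = lattice_box a b \<and> (\<forall>i. a $ i \<le> - K \<and> K \<le> b $ i)"
proof -
  have "boxes_to_infinity \<le> principal {lattice_box a b | a b. \<forall>i. a $ i \<le> - K \<and> K \<le> b $ i}"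
    unfolding boxes_to_infinity_def by (rule INF_lower) simp
  then have "\<forall>\<^sub>F \<Lambda> in boxes_to_infinity.
      \<Lambda> \<in> {lattice_box a b | a b. \<forall>i. a $ i \<le> - K \<and> K \<le> b $ i}"
    by (simp only: le_principal)
  then show ?thesis
    by (rule eventually_mono) blast
qed

text \<open>Bounds pass to limits only along a proper filter. Any finitely many of the generating
  sets share a cube, with \<open>K\<close> as half its side.\<close>

lemma boxes_to_infinity_neq_bot: "(boxes_to_infinity :: (real ^ 'n::finite) set filter) \<noteq> bot"
proof -
  define Q :: "int \<Rightarrow> (real ^ 'n) set set"
    where "Q k = {lattice_box a b | a b. \<forall>i. a $ i \<le> - k \<and> k \<le> b $ i}" for k
  have "(INF k. principal (Q k)) \<noteq> bot"
  proof (rule INF_filter_not_bot)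
    fix X :: "int set" assume X: "X \<subseteq> UNIV" "finite X"
    define K where "K = Max (insert 0 X)"
    have "lattice_box (\<chi> i. - K) (\<chi> i. K) \<in> Q k" if "k \<in> X" for k
    proof -
      have "k \<le> K" using that X(2) by (simp add: K_def)
      then show ?thesis unfolding Q_def by force
    qed
    then have "(\<Inter>k\<in>X. Q k) \<noteq> {}" by blast
    then show "(INF k\<in>X. principal (Q k)) \<noteq> bot"
      unfolding INF_principal_finite[OF X(2)] principal_eq_bot_iff .
  qed
  then show ?thesis
    by (simp add: boxes_to_infinity_def Q_def)
qed

text \<open>The constant in \<open>box_spectral_shift_bound\<close> is free of the box and of the
  realisation, so the bound survives the limit at any \<open>\<omega>\<close> where the limits
  exist.\<close>

theorem theorem2:
  fixes M :: "'w measure"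
    and V :: "'w \<Rightarrow> int ^ 'n::finite \<Rightarrow> real"
    and \<xi> :: "'w \<Rightarrow> (real ^ 'n) set \<Rightarrow> real \<Rightarrow> real"
    and \<Xi> :: signed_measure
  assumes "metrically_transitive M V"
    and "\<And>\<omega> a b. \<omega> \<in> space M \<Longrightarrow> (\<forall>i. a $ i \<le> b $ i) \<Longrightarrow>
      is_spectral_shift (h0 :: ('n, 'm::finite) lattice ell2 \<Rightarrow>\<^sub>L ('n, 'm) lattice ell2)
        (V_box (V \<omega>) (lattice_box a b)) (\<xi> \<omega> (lattice_box a b))"
    and "signed_borel_measure \<Xi>"
    and "AE \<omega> in M. \<forall>g\<in>C0_1.
      ((\<lambda>\<Lambda>. 1 / measure lborel \<Lambda> * (\<integral>t. g t * \<xi> \<omega> \<Lambda> t \<partial>lborel))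
        \<longlongrightarrow> signed_integral \<Xi> g) boxes_to_infinity"
  shows "signed_absolutely_continuous lborel \<Xi>"
proof (rule signed_absolutely_continuous_lborelI[OF assms(3)])
  interpret prob_space M
    using assms(1) by (simp add: metrically_transitive_def)
  \<comment> \<open>A property that holds almost surely in a probability space has a
    witness.\<close>
  have "\<exists>\<omega>\<in>space M. \<forall>g\<in>C0_1.
      ((\<lambda>\<Lambda>. 1 / measure lborel \<Lambda> * (\<integral>t. g t * \<xi> \<omega> \<Lambda> t \<partial>lborel))
        \<longlongrightarrow> signed_integral \<Xi> g) boxes_to_infinity"
  proof (rule ccontr)
    assume none: "\<not> ?thesis"
    have "AE \<omega> in M. False"
      using assms(4) by (rule AE_mp) (use none in \<open>auto intro!: AE_I2\<close>)
    then show False by simp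
  qed
  then obtain \<omega> where \<omega>: "\<omega> \<in> space M"
    and lim: "\<And>g. g \<in> C0_1 \<Longrightarrow> ((\<lambda>\<Lambda>. 1 / measure lborel \<Lambda> * (\<integral>t. g t * \<xi> \<omega> \<Lambda> t \<partial>lborel))
        \<longlongrightarrow> signed_integral \<Xi> g) boxes_to_infinity"
    by blast
  fix g assume g: "g \<in> C0_1"
  show "\<bar>signed_integral \<Xi> g\<bar> \<le> (2 ^ CARD('n) + 1) * (\<integral>t. \<bar>g t\<bar> \<partial>lborel)"
  proof (rule tendsto_upperbound[OF tendsto_rabs[OF lim[OF g]] _ boxes_to_infinity_neq_bot])
    show "\<forall>\<^sub>F \<Lambda> in boxes_to_infinity. \<bar>1 / measure lborel \<Lambda> * (\<integral>t. g t * \<xi> \<omega> \<Lambda> t \<partial>lborel)\<bar>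
        \<le> (2 ^ CARD('n) + 1) * (\<integral>t. \<bar>g t\<bar> \<partial>lborel)"
      \<comment> \<open>\<open>K = 1\<close> excludes degenerate boxes: every side then has length
        at least 2.\<close>
      using eventually_boxes_to_infinity[of 1]
    proof eventually_elim
      case (elim \<Lambda>)
      then obtain a b where \<Lambda>: "\<Lambda> = lattice_box a b" and ab: "\<And>i. a $ i \<le> - 1" "\<And>i. 1 \<le> b $ i"
        by blast
      have "a $ i \<le> b $ i" "a $ i + 1 \<le> b $ i" for i
        using ab(1)[of i] ab(2)[of i] by linarith+
      then show ?case
        unfolding \<Lambda> by (intro box_spectral_shift_bound[OF assms(2)[OF \<omega>]] C0_1_D[OF g]) auto
    qed
  qed
qed

end
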